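(* For every sufficiently small $t>0$ and every $u\in L^2(\mathcal M)$, $$\langle u,L_tu\rangle_{\mathcal M}\ge C\int_{\mathcal M}|\nabla v|^2\,d\mu_{\mathbf x},$$ where $C>0$ is a constant independent of $t$ and $u$, $\langle f,g\rangle_{\mathcal M}=\int_{\mathcal M}fg\,d\mu$, and $$v(\mathbf x)=\frac{C_t}{w_t(\mathbf x)}\int_{\mathcal M}R\Big(\frac{|\mathbf x-\mathbf y|^2}{4t}\Big)u(\mathbf y)\,d\mu_{\mathbf y},\qquad w_t(\mathbf x)=C_t\int_{\mathcal M}R\Big(\frac{|\mathbf x-\mathbf y|^2}{4t}\Big)d\mu_{\mathbf y}.$$
   Context: $\mathcal M$ is a compact $k$-dimensional $C^\infty$ submanifold of $\mathbb R^d$ with boundary $\partial\mathcal M$ a compact $C^\infty$ submanifold, with the induced metric, volume measure $\mu$, gradient $\nabla$. Kernel: $R:[0,\infty)\to[0,\infty)$ is $C^2$, $R(r)=0$ for $r>1$, $R(r)\ge\delta_0>0$ for $0\le r\le1/2$; $C_t=(4\pi t)^{-k/2}$, $R_t(\mathbf x,\mathbf y)=C_tR(|\mathbf x-\mathbf y|^2/(4t))$; $L_tu(\mathbf x)=\frac1t\int_{\mathcal M}R_t(\mathbf x,\mathbf y)(u(\mathbf x)-u(\mathbf y))d\mu_{\mathbf y}$. *)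

theory Defs
  imports "HOL-Analysis.Analysis"
begin

fun dderiv :: "'a::real_normed_vector list \<Rightarrow> ('a \<Rightarrow> 'b::real_normed_vector) \<Rightarrow> 'a \<Rightarrow> 'b" where
  "dderiv [] f = f"
| "dderiv (v # vs) f = (\<lambda>x. frechet_derivative (dderiv vs f) (at x) v)"

text \<open>f is C-infinity on the open set V: all iterated derivatives exist (hence are continuous).\<close>
definition smooth_on :: "'a::real_normed_vector set \<Rightarrow> ('a \<Rightarrow> 'b::real_normed_vector) \<Rightarrow> bool" where
  "smooth_on V f \<longleftrightarrow> (\<forall>vs. \<forall>x\<in>V. dderiv vs f differentiable (at x))"

text \<open>Model spaces: the whole R^k (interior charts) or a closed half space (boundary charts).\<close>
definition model_sets :: "(real^'k::finite) set set" where
  "model_sets = insert UNIV {{z. 0 \<le> z $ i} | i. True}"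

definition is_chart :: "(real^'d::finite) set \<Rightarrow> (real^'k::finite \<Rightarrow> real^'d) \<Rightarrow> (real^'k) set \<Rightarrow> (real^'k) set \<Rightarrow> bool" where
  "is_chart M \<phi> V H \<longleftrightarrow> open V \<and> H \<in> model_sets \<and> smooth_on V \<phi> \<and>
     (\<forall>z\<in>V. inj (frechet_derivative \<phi> (at z))) \<and>
     (\<exists>U g. open U \<and> homeomorphism (V \<inter> H) (M \<inter> U) \<phi> g)"

definition smooth_submanifold_with_boundary :: "'k::finite itself \<Rightarrow> (real^'d::finite) set \<Rightarrow> bool" where
  "smooth_submanifold_with_boundary (_::'k itself) M \<longleftrightarrow>
     (\<forall>p\<in>M. \<exists>(\<phi>::real^'k \<Rightarrow> real^'d) V H. is_chart M \<phi> V H \<and> p \<in> \<phi> ` (V \<inter> H))"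

definition jacobian_vol :: "(real^'k::finite \<Rightarrow> real^'d::finite) \<Rightarrow> real^'k \<Rightarrow> real" where
  "jacobian_vol \<phi> z = (let J = matrix (frechet_derivative \<phi> (at z)) in sqrt (det (transpose J ** J)))"

text \<open>mu is the Riemannian volume measure of M (induced metric): a Borel measure on M which in every
  chart is given by the area formula.\<close>
definition is_volume_measure :: "'k::finite itself \<Rightarrow> (real^'d::finite) set \<Rightarrow> (real^'d) measure \<Rightarrow> bool" where
  "is_volume_measure (_::'k itself) M \<mu> \<longleftrightarrow>
     sets \<mu> = sets (restrict_space borel M) \<and>
     (\<forall>(\<phi>::real^'k \<Rightarrow> real^'d) V H A. is_chart M \<phi> V H \<longrightarrow> A \<in> sets lborel \<longrightarrow> A \<subseteq> V \<inter> H \<longrightarrow>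
        emeasure \<mu> (\<phi> ` A) = (\<integral>\<^sup>+ z. indicator A z * ennreal (jacobian_vol \<phi> z) \<partial>lborel))"

definition tangent_space :: "'k::finite itself \<Rightarrow> (real^'d::finite) set \<Rightarrow> real^'d \<Rightarrow> (real^'d) set" where
  "tangent_space (_::'k itself) M x =
     (SOME T. \<exists>(\<phi>::real^'k \<Rightarrow> real^'d) V H z. is_chart M \<phi> V H \<and> z \<in> V \<inter> H \<and> \<phi> z = x \<and>
        T = range (frechet_derivative \<phi> (at z)))"

definition ambient_grad :: "(real^'d::finite \<Rightarrow> real) \<Rightarrow> real^'d \<Rightarrow> real^'d" where
  "ambient_grad f x = (\<Sum>b\<in>Basis. frechet_derivative f (at x) b *\<^sub>R b)"

text \<open>Gradient on M with respect to the induced metric: projection of the ambient gradient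
  onto the tangent space.\<close>
definition mgrad :: "'k::finite itself \<Rightarrow> (real^'d::finite) set \<Rightarrow> (real^'d \<Rightarrow> real) \<Rightarrow> real^'d \<Rightarrow> real^'d" where
  "mgrad K M f x = closest_point (tangent_space K M x) (ambient_grad f x)"

definition kernel_ok :: "(real \<Rightarrow> real) \<Rightarrow> bool" where
  "kernel_ok R \<longleftrightarrow>
     (\<exists>R' R''. (\<forall>r\<ge>0. (R has_real_derivative R' r) (at r within {0..}) \<and>
                        (R' has_real_derivative R'' r) (at r within {0..})) \<and>
               continuous_on {0..} R'') \<and>
     (\<forall>r\<ge>0. R r \<ge> 0) \<and> (\<forall>r>1. R r = 0) \<and>
     (\<exists>\<delta>0>0. \<forall>r. 0 \<le> r \<and> r \<le> 1/2 \<longrightarrow> R r \<ge> \<delta>0)"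

definition Ct :: "nat \<Rightarrow> real \<Rightarrow> real" where
  "Ct k t = (4 * pi * t) powr (- (real k / 2))"

definition Rt :: "nat \<Rightarrow> (real \<Rightarrow> real) \<Rightarrow> real \<Rightarrow> real^'d::finite \<Rightarrow> real^'d \<Rightarrow> real" where
  "Rt k R t x y = Ct k t * R ((norm (x - y))\<^sup>2 / (4 * t))"

definition Lt :: "nat \<Rightarrow> (real \<Rightarrow> real) \<Rightarrow> (real^'d::finite) measure \<Rightarrow> real \<Rightarrow> (real^'d \<Rightarrow> real) \<Rightarrow> real^'d \<Rightarrow> real" where
  "Lt k R \<mu> t u x = (1 / t) * (\<integral>y. Rt k R t x y * (u x - u y) \<partial>\<mu>)"

definition wt :: "nat \<Rightarrow> (real \<Rightarrow> real) \<Rightarrow> (real^'d::finite) measure \<Rightarrow> real \<Rightarrow> real^'d \<Rightarrow> real" where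
  "wt k R \<mu> t x = Ct k t * (\<integral>y. R ((norm (x - y))\<^sup>2 / (4 * t)) \<partial>\<mu>)"

definition vt :: "nat \<Rightarrow> (real \<Rightarrow> real) \<Rightarrow> (real^'d::finite) measure \<Rightarrow> real \<Rightarrow> (real^'d \<Rightarrow> real) \<Rightarrow> real^'d \<Rightarrow> real" where
  "vt k R \<mu> t u x = Ct k t / wt k R \<mu> t x * (\<integral>y. R ((norm (x - y))\<^sup>2 / (4 * t)) * u y \<partial>\<mu>)"

definition L2 :: "(real^'d::finite) measure \<Rightarrow> (real^'d \<Rightarrow> real) set" where
  "L2 \<mu> = {u. u \<in> borel_measurable \<mu> \<and> integrable \<mu> (\<lambda>x. (u x)\<^sup>2)}"

end

theory Submission
  imports Defs
begin

text \<open>Since \<open>R\<close> is \<open>C\<^sup>2\<close> and nonnegative with compact support, \<open>(R')\<^sup>2 \<le> A R\<close>.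
  As averaging fixes constants, the gradient of \<open>v\<close> at \<open>x\<close> only involves the differences \<open>u y - u x\<close>,
  and Cauchy-Schwarz together with \<open>(R')\<^sup>2 \<le> A R\<close> bounds \<open>\<bar>\<nabla>v(x)\<bar>\<^sup>2\<close> pointwise by a constant times
  \<open>t\<^sup>-\<^sup>1 \<integral> R\<^sub>t(x,y) (u x - u y)\<^sup>2 dy\<close>; the constant is uniform because balls of radius \<open>r\<close> centred
  on \<open>M\<close> have volume comparable to \<open>r\<^sup>k\<close>. Integrating over \<open>x\<close> and symmetrising gives
  twice \<open>\<langle>u, L\<^sub>t u\<rangle>\<close>.\<close>

subsection \<open>Ball volumes\<close>

text \<open>The formula for \<open>v\<close> makes sense on the whole ambient space, so no
  derivative along \<open>M\<close> is ever taken: projecting onto a tangent space can only shorten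
  the ambient gradient, and boundary points need no separate treatment. The obstacle is the weight.
  Differentiating under the integral and applying Cauchy-Schwarz leaves the weight
  \<open>(R')\<^sup>2\<close>, whereas the energy carries \<open>R\<close>; without a pointwise
  comparison of the two, energies of different kernels would have to be related. The powers of
  \<open>t\<close> then match exactly. With \<open>s = sqrt t\<close>, balls of radius
  \<open>3 * s\<close> have mass at most of order \<open>s ^ k\<close>, and the integral of the
  kernel is at least of that order. The bound on the squared gradient thus carries
  \<open>s ^ k / (t * s ^ (2 * k)) = 1 / (t * s ^ k)\<close>, and \<open>1 / s ^ k\<close> is
  \<open>Ct k t\<close> up to a fixed factor, which is what stands in front of the quadratic form.
  The upper volume bound serves the numerator, the lower one the denominator.\<close>

lemma det_gram_pos:
  fixes A :: "real^'k^'d"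
  assumes "inj ((*v) A)"
  shows "0 < det (transpose A ** A)"
proof -
  \<comment> \<open>A path of invertible matrices from the identity to the Gram matrix: the determinant keeps its sign.\<close>
  define G where "G s = (\<chi> i j. s * (transpose A ** A) $ i $ j + (1 - s) * (mat 1 :: real^'k^'k) $ i $ j)" for s :: real
  have Gv: "G s *v x = s *\<^sub>R ((transpose A ** A) *v x) + (1 - s) *\<^sub>R x" for s x
  proof -
    have "G s = s *\<^sub>R (transpose A ** A) + (1 - s) *\<^sub>R mat 1"
      by (simp add: G_def vec_eq_iff)
    then show ?thesis
      by (simp add: matrix_vector_mult_add_rdistrib scaleR_matrix_vector_assoc[symmetric])
  qed
  have nz: "det (G s) \<noteq> 0" if "0 \<le> s" "s \<le> 1" for s
  proof -
    have "x = 0" if "G s *v x = 0" for x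
    proof -
      have "0 = x \<bullet> (G s *v x)"
        using that by simp
      also have "\<dots> = s * (norm (A *v x))\<^sup>2 + (1 - s) * (norm x)\<^sup>2"
        by (simp only: Gv inner_add_right inner_scaleR_right matrix_vector_mul_assoc[symmetric]
            dot_lmul_matrix[symmetric] vector_transpose_matrix power2_norm_eq_inner)
      finally have eq: "s * (norm (A *v x))\<^sup>2 + (1 - s) * (norm x)\<^sup>2 = 0"
        by simp
      then have z: "s * (norm (A *v x))\<^sup>2 = 0" "(1 - s) * (norm x)\<^sup>2 = 0"
        using \<open>0 \<le> s\<close> \<open>s \<le> 1\<close> by (simp_all add: add_nonneg_eq_0_iff)
      show "x = 0"
      proof (cases "s = 1")
        case True
        then have "A *v x = A *v 0" using z by simp
        then show ?thesis using assms by (metis injD)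
      qed (use z in auto)
    qed
    then have "inj ((*v) (G s))"
      by (subst linear_injective_0) auto
    then show ?thesis
      by (simp add: invertible_det_nz[symmetric] invertible_left_inverse matrix_left_invertible_injective)
  qed
  have cont: "continuous_on {0..1} (\<lambda>s. det (G s))"
    unfolding det_def G_def by (auto intro!: continuous_intros)
  have "G 0 = mat 1" "G 1 = transpose A ** A"
    by (simp_all add: G_def vec_eq_iff)
  then have "det (G 0) = 1" "det (G 1) = det (transpose A ** A)" by simp_all
  moreover have "\<not> det (G 1) \<le> 0"
  proof
    assume "det (G 1) \<le> 0"
    then obtain s where "0 \<le> s" "s \<le> 1" "det (G s) = 0"
      using IVT2'[of "\<lambda>s. det (G s)" 1 0 0] cont \<open>det (G 0) = 1\<close> by auto
    then show False using nz by blast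
  qed
  ultimately show ?thesis by simp
qed

section \<open>Charts: Jacobian density and two-sided distance bounds\<close>

lemma smooth_on_has_derivative:
  assumes "smooth_on V f" "z \<in> V"
  shows "(f has_derivative frechet_derivative f (at z)) (at z)"
  using assms unfolding smooth_on_def by (metis dderiv.simps(1) frechet_derivative_works)

lemma smooth_on_isCont_frechet_derivative:
  assumes "smooth_on V f" "z \<in> V"
  shows "isCont (\<lambda>z. frechet_derivative f (at z) v) z"
proof -
  have "dderiv [v] f differentiable (at z)"
    using assms unfolding smooth_on_def by blast
  then show ?thesis
    by (simp add: differentiable_imp_continuous_within)
qed

lemma isCont_jacobian_vol:
  fixes \<phi> :: "real^'k \<Rightarrow> real^'d"
  assumes "smooth_on V \<phi>" "z \<in> V"
  shows "isCont (jacobian_vol \<phi>) z"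
  unfolding jacobian_vol_def[abs_def] Let_def det_def matrix_def transpose_def matrix_matrix_mult_def
  using smooth_on_isCont_frechet_derivative[OF assms]
  by (auto intro!: continuous_intros)

lemma jacobian_vol_pos:
  fixes \<phi> :: "real^'k \<Rightarrow> real^'d"
  assumes "smooth_on V \<phi>" "z \<in> V" "inj (frechet_derivative \<phi> (at z))"
  shows "0 < jacobian_vol \<phi> z"
proof -
  have "linear (frechet_derivative \<phi> (at z))"
    using smooth_on_has_derivative[OF assms(1,2)] by (rule has_derivative_linear)
  then have "(*v) (matrix (frechet_derivative \<phi> (at z))) = frechet_derivative \<phi> (at z)"
    by (auto simp: matrix_works)
  then have "0 < det (transpose (matrix (frechet_derivative \<phi> (at z))) ** matrix (frechet_derivative \<phi> (at z)))"
    using assms(3) by (intro det_gram_pos) simp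
  then show ?thesis
    by (simp add: jacobian_vol_def Let_def)
qed

lemma linear_componentwise_repr:
  fixes f :: "'a::euclidean_space \<Rightarrow> 'b::real_vector"
  assumes "linear f"
  shows "f x = (\<Sum>b\<in>Basis. (x \<bullet> b) *\<^sub>R f b)"
proof -
  have "f x = f (\<Sum>b\<in>Basis. (x \<bullet> b) *\<^sub>R b)"
    by (simp only: euclidean_representation)
  also have "\<dots> = (\<Sum>b\<in>Basis. (x \<bullet> b) *\<^sub>R f b)"
    by (simp only: linear_sum[OF assms] linear_scale[OF assms])
  finally show ?thesis .
qed

text \<open>Near \<open>z\<close> the map is a small perturbation of its injective linearisation:
  \<open>f - D z\<close> has Lipschitz constant \<open>B / 2\<close> there, while \<open>D z\<close>
  stretches every vector by a factor of at least \<open>B\<close>. Source and target may differ in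
  dimension, so the inverse function theorem does not apply directly.\<close>

lemma smooth_on_locally_bilipschitz:
  fixes f :: "'a::euclidean_space \<Rightarrow> 'b::euclidean_space"
  assumes sm: "smooth_on V f" and V: "open V" "z \<in> V"
    and inj: "inj (frechet_derivative f (at z))"
  obtains \<rho> m L where "0 < \<rho>" "0 < m" "0 < L" "ball z \<rho> \<subseteq> V"
    "\<And>a b. a \<in> ball z \<rho> \<Longrightarrow> b \<in> ball z \<rho> \<Longrightarrow> m * dist a b \<le> dist (f a) (f b)"
    "\<And>a b. a \<in> ball z \<rho> \<Longrightarrow> b \<in> ball z \<rho> \<Longrightarrow> dist (f a) (f b) \<le> L * dist a b"
proof -
  define D where "D w = frechet_derivative f (at w)" for w
  have der: "(f has_derivative D w) (at w)" if "w \<in> V" for w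
    unfolding D_def by (rule smooth_on_has_derivative[OF sm that])
  have bl: "bounded_linear (D w)" if "w \<in> V" for w
    using der[OF that] by (rule has_derivative_bounded_linear)
  obtain B where B: "B > 0" "\<And>x. B * norm x \<le> norm (D z x)"
    using linear_inj_bounded_below_pos[of "D z"] inj bl[OF V(2)]
    by (metis D_def bounded_linear.linear)
  obtain K where K: "K > 0" "\<And>x. norm (D z x) \<le> norm x * K"
    using bounded_linear.pos_bounded[OF bl[OF V(2)]] by blast
  \<comment> \<open>\<open>smooth_on\<close> yields continuity of the derivative one direction at a
    time; the sum over the finite basis turns this into control of the operator norm.\<close>
  have "isCont (\<lambda>w. \<Sum>b\<in>Basis. norm (D w b - D z b)) z"
    unfolding D_def by (intro continuous_intros smooth_on_isCont_frechet_derivative[OF sm V(2)])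
  then have "((\<lambda>w. \<Sum>b\<in>Basis. norm (D w b - D z b)) \<longlongrightarrow> 0) (at z)"
    by (simp add: isCont_def)
  then have "\<forall>\<^sub>F w in at z. (\<Sum>b\<in>Basis. norm (D w b - D z b)) < B / 2"
    using B(1) by (intro order_tendstoD) auto
  then obtain d where d: "d > 0" "\<And>w. w \<noteq> z \<Longrightarrow> dist w z < d \<Longrightarrow> (\<Sum>b\<in>Basis. norm (D w b - D z b)) < B / 2"
    unfolding eventually_at by auto
  obtain e where e: "e > 0" "ball z e \<subseteq> V"
    using V open_contains_ball by blast
  define \<rho> where "\<rho> = min d e"
  have \<rho>: "\<rho> > 0" "ball z \<rho> \<subseteq> V" using d e by (auto simp: \<rho>_def)
  have main: "norm ((f a - D z a) - (f b - D z b)) \<le> B / 2 * norm (a - b)"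
    if "a \<in> ball z \<rho>" "b \<in> ball z \<rho>" for a b
  proof (rule differentiable_bound[where f' = "\<lambda>w h. D w h - D z h" and S = "ball z \<rho>"])
    fix w assume w: "w \<in> ball z \<rho>"
    then have wV: "w \<in> V" using \<rho> by auto
    show "((\<lambda>a. f a - D z a) has_derivative (\<lambda>h. D w h - D z h)) (at w within ball z \<rho>)"
      by (intro has_derivative_diff has_derivative_at_withinI[OF der[OF wV]]
          bounded_linear_imp_has_derivative bl V)
    have s: "(\<Sum>b\<in>Basis. norm (D w b - D z b)) \<le> B / 2"
      using d(2)[of w] w B(1) by (cases "w = z") (auto simp: \<rho>_def dist_commute intro: less_imp_le)
    show "onorm (\<lambda>h. D w h - D z h) \<le> B / 2"
    proof (rule onorm_le)
      fix h
      have "linear (\<lambda>h. D w h - D z h)"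
        using bl[OF wV] bl[OF V(2)] by (intro linear_compose_sub bounded_linear.linear)
      then have "D w h - D z h = (\<Sum>b\<in>Basis. (h \<bullet> b) *\<^sub>R (D w b - D z b))"
        using linear_componentwise_repr[of "\<lambda>h. D w h - D z h" h] by simp
      also have "norm \<dots> \<le> (\<Sum>b\<in>Basis. norm h * norm (D w b - D z b))"
        by (rule sum_norm_le) (auto intro!: mult_right_mono Basis_le_norm)
      also have "\<dots> = norm h * (\<Sum>b\<in>Basis. norm (D w b - D z b))"
        by (simp add: sum_distrib_left)
      also have "\<dots> \<le> norm h * (B / 2)"
        by (intro mult_left_mono s) auto
      finally show "norm (D w h - D z h) \<le> B / 2 * norm h"
        by (simp add: mult.commute)
    qed
  qed (use that in auto)
  have lin: "D z (a - b) = D z a - D z b" for a b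
    using bl[OF V(2)] by (simp add: linear_diff bounded_linear.linear)
  have 1: "B / 2 * dist a b \<le> dist (f a) (f b)" if "a \<in> ball z \<rho>" "b \<in> ball z \<rho>" for a b
  proof -
    have "norm (D z a - D z b) \<le> norm (f a - f b) + norm ((f a - D z a) - (f b - D z b))"
      using norm_triangle_ineq4[of "f a - f b" "(f a - D z a) - (f b - D z b)"]
      by (simp add: algebra_simps)
    then show ?thesis
      using main[OF that] B(2)[of "a - b"] by (simp add: lin dist_norm)
  qed
  have 2: "dist (f a) (f b) \<le> (K + B / 2) * dist a b" if "a \<in> ball z \<rho>" "b \<in> ball z \<rho>" for a b
  proof -
    have "norm (f a - f b) \<le> norm (D z a - D z b) + norm ((f a - D z a) - (f b - D z b))"
      using norm_triangle_ineq[of "D z a - D z b" "(f a - D z a) - (f b - D z b)"]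
      by (simp add: algebra_simps)
    then show ?thesis
      using main[OF that] K(2)[of "a - b"] by (simp add: lin dist_norm algebra_simps)
  qed
  show ?thesis
    using that[OF \<rho>(1) _ _ \<rho>(2) 1 2] B(1) K(1) by simp
qed

section \<open>Volumes of small balls centred on the manifold\<close>

lemma emeasure_lborel_vec_cube:
  fixes a :: "real^'k"
  assumes "0 \<le> s"
  shows emeasure_lborel_vec_box: "emeasure lborel (box a (a + (\<chi> i. s))) = ennreal (s ^ CARD('k))"
    and emeasure_lborel_vec_cbox: "emeasure lborel (cbox a (a + (\<chi> i. s))) = ennreal (s ^ CARD('k))"
proof -
  have le: "a \<bullet> b \<le> (a + (\<chi> i. s)) \<bullet> b" if "b \<in> Basis" for b
    using assms that by (auto simp: Basis_vec_def inner_axis algebra_simps)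
  have "(\<Prod>b\<in>(Basis::(real^'k) set). (a + (\<chi> i. s) - a) \<bullet> b) = (\<Prod>b\<in>(Basis::(real^'k) set). s)"
    by (intro prod.cong) (auto simp: Basis_vec_def inner_axis)
  then show "emeasure lborel (box a (a + (\<chi> i. s))) = ennreal (s ^ CARD('k))"
    "emeasure lborel (cbox a (a + (\<chi> i. s))) = ennreal (s ^ CARD('k))"
    using le by (simp_all only: emeasure_lborel_box emeasure_lborel_cbox prod_constant DIM_cart DIM_real mult_1_right)
qed

lemma model_sets_closed: "H \<in> model_sets \<Longrightarrow> closed H"
  unfolding model_sets_def by (auto intro!: closed_Collect_le continuous_intros)

text \<open>A cube whose lowest corner lies in a model space never leaves it. This lets interior and
  boundary charts be treated alike.\<close>

lemma model_sets_mono: "H \<in> model_sets \<Longrightarrow> a \<in> H \<Longrightarrow> (\<And>i. a $ i \<le> z $ i) \<Longrightarrow> z \<in> H"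
  unfolding model_sets_def by (auto intro: order_trans)

lemma chart_volume_bounds:
  fixes \<phi> :: "real^'k \<Rightarrow> real^'d"
  assumes vol: "is_volume_measure TYPE('k) M \<mu>" and ch: "is_chart M \<phi> V H"
    and A: "A \<in> sets lborel" "A \<subseteq> V \<inter> H"
  shows "(\<And>z. z \<in> A \<Longrightarrow> jacobian_vol \<phi> z \<le> c) \<Longrightarrow> emeasure \<mu> (\<phi> ` A) \<le> ennreal c * emeasure lborel A"
    and "(\<And>z. z \<in> A \<Longrightarrow> c \<le> jacobian_vol \<phi> z) \<Longrightarrow> ennreal c * emeasure lborel A \<le> emeasure \<mu> (\<phi> ` A)"
proof -
  have eq: "emeasure \<mu> (\<phi> ` A) = (\<integral>\<^sup>+ z. indicator A z * ennreal (jacobian_vol \<phi> z) \<partial>lborel)"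
    using assms unfolding is_volume_measure_def by blast
  have c: "ennreal c * emeasure lborel A = (\<integral>\<^sup>+ z. indicator A z * ennreal c \<partial>lborel)"
    using A(1) by (simp add: nn_integral_cmult_indicator mult.commute)
  show "emeasure \<mu> (\<phi> ` A) \<le> ennreal c * emeasure lborel A"
    if "\<And>z. z \<in> A \<Longrightarrow> jacobian_vol \<phi> z \<le> c"
    unfolding eq c using that by (intro nn_integral_mono) (auto simp: indicator_def intro: ennreal_leI)
  show "ennreal c * emeasure lborel A \<le> emeasure \<mu> (\<phi> ` A)"
    if "\<And>z. z \<in> A \<Longrightarrow> c \<le> jacobian_vol \<phi> z"
    unfolding eq c using that by (intro nn_integral_mono) (auto simp: indicator_def intro: ennreal_leI)
qed

text \<open>A chart changes lengths by factors between \<open>m\<close> and \<open>L\<close> and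
  volumes by factors between \<open>J / 2\<close> and \<open>2 * J\<close>. Hence the ball contains
  the image of one cube and is the image of a subset of another, both of side proportional to
  \<open>r\<close>. The centre \<open>x\<close> varies near \<open>p\<close> with fixed constants,
  as the compactness argument requires.\<close>

lemma volume_measure_ball_bounds_local:
  fixes M :: "(real^'d) set"
  assumes mf: "smooth_submanifold_with_boundary TYPE('k::finite) M"
    and vol: "is_volume_measure TYPE('k) M \<mu>" and cM: "closed M" and p: "p \<in> M"
  shows "\<exists>e>0. \<exists>c>0. \<exists>C>0. \<forall>x\<in>M \<inter> ball p e. \<forall>r. 0 < r \<and> r < e \<longrightarrow>
    ennreal (c * r ^ CARD('k)) \<le> emeasure \<mu> (M \<inter> ball x r) \<and>
    emeasure \<mu> (M \<inter> ball x r) \<le> ennreal (C * r ^ CARD('k))"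
proof -
  let ?k = "CARD('k)"
  obtain \<phi> :: "real^'k \<Rightarrow> real^'d" and V H where ch: "is_chart M \<phi> V H" and "p \<in> \<phi> ` (V \<inter> H)"
    using mf p unfolding smooth_submanifold_with_boundary_def by meson
  then obtain z where z: "z \<in> V" "z \<in> H" "\<phi> z = p" by blast
  from ch obtain U g where V: "open V" and H: "H \<in> model_sets" and sm: "smooth_on V \<phi>"
    and inj: "inj (frechet_derivative \<phi> (at z))"
    and U: "open U" and hom: "homeomorphism (V \<inter> H) (M \<inter> U) \<phi> g"
    using z unfolding is_chart_def by blast
  have setsM: "M \<inter> ball x r \<in> sets \<mu>" for x r
    using vol cM unfolding is_volume_measure_def by (simp add: sets_restrict_space image_iff) (metis borel_open inf_commute open_ball)
  have \<phi>M: "\<phi> w \<in> M" if "w \<in> V \<inter> H" for w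
    using hom that by (metis IntD1 homeomorphism_image1 image_eqI)
  obtain \<rho>1 m L where \<rho>1: "0 < \<rho>1" "ball z \<rho>1 \<subseteq> V" and mL: "0 < m" "0 < L"
    and lo: "\<And>a b. a \<in> ball z \<rho>1 \<Longrightarrow> b \<in> ball z \<rho>1 \<Longrightarrow> m * dist a b \<le> dist (\<phi> a) (\<phi> b)"
    and up: "\<And>a b. a \<in> ball z \<rho>1 \<Longrightarrow> b \<in> ball z \<rho>1 \<Longrightarrow> dist (\<phi> a) (\<phi> b) \<le> L * dist a b"
    using smooth_on_locally_bilipschitz[OF sm V z(1) inj] by metis
  define J where "J = jacobian_vol \<phi> z"
  have J: "0 < J" unfolding J_def by (rule jacobian_vol_pos[OF sm z(1) inj])
  have "\<forall>\<^sub>F w in nhds z. J / 2 < jacobian_vol \<phi> w \<and> jacobian_vol \<phi> w < 2 * J"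
    using isCont_jacobian_vol[OF sm z(1)] J
    by (intro eventually_conj order_tendstoD[where y = J]) (auto simp: J_def isCont_def tendsto_at_iff_tendsto_nhds)
  then obtain \<rho>2 where \<rho>2: "\<rho>2 > 0" "\<And>w. dist w z < \<rho>2 \<Longrightarrow> J / 2 < jacobian_vol \<phi> w \<and> jacobian_vol \<phi> w < 2 * J"
    unfolding eventually_nhds_metric by auto
  \<comment> \<open>Half of the common radius: parameters of centres lie within
    \<open>\<rho>\<close> of \<open>z\<close>, which leaves another \<open>\<rho>\<close> for the
    cubes built on them.\<close>
  define \<rho> where "\<rho> = min \<rho>1 \<rho>2 / 2"
  have \<rho>: "0 < \<rho>" "ball z (2 * \<rho>) \<subseteq> V" and \<rho>b: "\<And>w. w \<in> ball z (2 * \<rho>) \<Longrightarrow> w \<in> ball z \<rho>1"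
    and Jb: "\<And>w. w \<in> ball z (2 * \<rho>) \<Longrightarrow> J / 2 \<le> jacobian_vol \<phi> w \<and> jacobian_vol \<phi> w \<le> 2 * J"
    using \<rho>1 \<rho>2(1) \<rho>2(2) by (auto simp: \<rho>_def dist_commute intro: less_imp_le)
  have gp: "g p = z" using hom z by (metis IntI homeomorphism_apply1)
  have pU: "p \<in> M \<inter> U" using hom z by (metis IntI homeomorphism_image1 image_eqI)
  \<comment> \<open>The chart image is relatively open in \<open>M\<close> and its inverse is
    continuous, which excludes other sheets of \<open>M\<close> close to \<open>p\<close>: every
    point of \<open>M\<close> near \<open>p\<close> has a parameter near \<open>z\<close>.\<close>
  have "continuous_on (M \<inter> U) g" using hom by (rule homeomorphism_cont2)
  then obtain e1 where e1: "e1 > 0" "\<And>y. y \<in> M \<inter> U \<Longrightarrow> dist y p < e1 \<Longrightarrow> dist (g y) z < \<rho>"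
    using pU \<rho>(1) gp unfolding continuous_on_iff by metis
  obtain e2 where e2: "e2 > 0" "ball p e2 \<subseteq> U" using U pU open_contains_ball by blast
  \<comment> \<open>For \<open>r < e\<close>, the bound \<open>L * \<rho>\<close> keeps cubes
    reaching \<open>r / L\<close> from their corner inside the chart; the halving keeps
    \<open>ball x r\<close> within \<open>2 * e\<close> of \<open>p\<close>, where parameters are
    available.\<close>
  define e where "e = min (min e1 e2 / 2) (L * \<rho>)"
  have e: "e > 0" "e \<le> L * \<rho>" "2 * e \<le> e1" "2 * e \<le> e2" using e1 e2 mL \<rho>(1) by (auto simp: e_def)
  have chart: "\<exists>a. a \<in> V \<inter> H \<and> a \<in> ball z \<rho> \<and> \<phi> a = y" if "y \<in> M" "dist p y < 2 * e" for y
  proof -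
    have yU: "y \<in> M \<inter> U" using that e e2 by auto
    then have "g y \<in> V \<inter> H" "\<phi> (g y) = y" using hom by (auto simp: homeomorphism_def)
    moreover have "dist z (g y) < \<rho>" using e1(2)[OF yU] that e by (simp add: dist_commute)
    ultimately show ?thesis by auto
  qed
  \<comment> \<open>\<open>J / 2\<close> and \<open>2 * J\<close> bound the density. The inner cube
    has side \<open>r / (L * k)\<close>, so that \<open>k\<close> coordinate differences add up to
    less than \<open>r / L\<close>; the outer cube has side \<open>2 * r / m\<close>.\<close>
  define c where "c = J / 2 * (1 / (L * real ?k)) ^ ?k"
  define C where "C = 2 * J * (2 / m) ^ ?k"
  have "ennreal (c * r ^ ?k) \<le> emeasure \<mu> (M \<inter> ball x r) \<and> emeasure \<mu> (M \<inter> ball x r) \<le> ennreal (C * r ^ ?k)"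
    if x: "x \<in> M" "dist p x < e" and r: "0 < r" "r < e" for x r
  proof -
    obtain a where a: "a \<in> V" "a \<in> H" "a \<in> ball z \<rho>" "\<phi> a = x"
      using chart[OF x(1)] x e by auto
    have a2: "a \<in> ball z (2 * \<rho>)" using a \<rho> by auto
    define s where "s = r / (L * real ?k)"
    have s: "s > 0" using r mL by (simp add: s_def)
    \<comment> \<open>The point \<open>a\<close> is the lowest corner rather than the centre: if
      \<open>x\<close> is a boundary point, only increasing the coordinates is sure to stay in
      \<open>H\<close>.\<close>
    define Q where "Q = box a (a + (\<chi> i. s))"
    have Qn: "norm (w - a) < r / L" if "w \<in> Q" for w
    proof -
      have "\<bar>(w - a) $ i\<bar> < s" for i
      proof -
        have "a $ i < w $ i \<and> w $ i < s + a $ i"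
          using that by (simp add: Q_def mem_box_cart algebra_simps)
        then show ?thesis by (simp add: abs_less_iff)
      qed
      then have "(\<Sum>i\<in>UNIV. \<bar>(w - a) $ i\<bar>) < (\<Sum>i\<in>(UNIV::'k set). s)"
        by (intro sum_strict_mono) auto
      then show ?thesis using norm_le_l1_cart[of "w - a"] by (simp add: s_def)
    qed
    have Qz: "w \<in> ball z (2 * \<rho>)" if "w \<in> Q" for w
    proof -
      have "r / L \<le> \<rho>" using r e mL by (simp add: divide_le_eq mult.commute)
      then have "dist a w < \<rho>" using Qn[OF that] by (simp add: dist_norm norm_minus_commute)
      then show ?thesis using a(3) dist_triangle[of z w a] by simp
    qed
    have QH: "Q \<subseteq> V \<inter> H"
    proof
      fix w assume w: "w \<in> Q"
      then have "a $ i \<le> w $ i" for i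
        by (simp add: Q_def mem_box_cart less_imp_le)
      then show "w \<in> V \<inter> H"
        using model_sets_mono[OF H a(2)] Qz[OF w] \<rho>(2) by blast
    qed
    have QM: "\<phi> ` Q \<subseteq> M \<inter> ball x r"
    proof
      fix y assume "y \<in> \<phi> ` Q"
      then obtain w where w: "w \<in> Q" and y: "y = \<phi> w" by blast
      have "dist (\<phi> a) (\<phi> w) \<le> L * dist a w" using up \<rho>b Qz[OF w] a2 by simp
      also have "\<dots> < r" using Qn[OF w] mL by (simp add: dist_norm norm_minus_commute pos_less_divide_eq mult.commute)
      moreover have "\<phi> w \<in> M" using QH w \<phi>M by blast
      ultimately show "y \<in> M \<inter> ball x r" using a y by simp
    qed
    have "c * r ^ ?k = J / 2 * s ^ ?k" by (simp add: c_def s_def power_divide)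
    then have "ennreal (c * r ^ ?k) = ennreal (J / 2) * ennreal (s ^ ?k)"
      using J s by (simp add: ennreal_mult del: times_divide_eq_left)
    also have "\<dots> = ennreal (J / 2) * emeasure lborel Q"
      using s by (simp add: Q_def emeasure_lborel_vec_box)
    also have "\<dots> \<le> emeasure \<mu> (\<phi> ` Q)"
      using Jb Qz by (intro chart_volume_bounds(2)[OF vol ch _ QH]) (auto simp: Q_def)
    also have "\<dots> \<le> emeasure \<mu> (M \<inter> ball x r)"
      by (intro emeasure_mono QM setsM)
    finally have 1: "ennreal (c * r ^ ?k) \<le> emeasure \<mu> (M \<inter> ball x r)" .

    \<comment> \<open>The whole ball read in the chart: an open set intersected with the closed
      model space, hence Borel.\<close>
    define A where "A = {w \<in> ball z (2 * \<rho>). \<phi> w \<in> ball x r} \<inter> H"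
    have "continuous_on (ball z (2 * \<rho>)) \<phi>"
      using smooth_on_has_derivative[OF sm] \<rho>(2)
      by (intro continuous_at_imp_continuous_on) (meson has_derivative_continuous subsetD)
    then have "open {w \<in> ball z (2 * \<rho>). \<phi> w \<in> ball x r}"
      using continuous_open_preimage[of "ball z (2 * \<rho>)" \<phi> "ball x r"]
      by (simp add: vimage_def Int_def)
    then have As: "A \<in> sets lborel"
      unfolding A_def using model_sets_closed[OF H] by (auto intro!: sets.Int)
    have AVH: "A \<subseteq> V \<inter> H" using \<rho>(2) by (auto simp: A_def)
    have AM: "M \<inter> ball x r = \<phi> ` A"
    proof
      show "\<phi> ` A \<subseteq> M \<inter> ball x r" using AVH \<phi>M by (auto simp: A_def)
      show "M \<inter> ball x r \<subseteq> \<phi> ` A"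
      proof
        fix y assume y: "y \<in> M \<inter> ball x r"
        from y have "dist p y < 2 * e" using x r dist_triangle[of p y x] by simp
        then obtain b where b: "b \<in> V \<inter> H \<and> b \<in> ball z \<rho> \<and> \<phi> b = y" using chart y by blast
        then have "b \<in> A" using y \<rho>(1) by (auto simp: A_def)
        then show "y \<in> \<phi> ` A" using b by blast
      qed
    qed
    define a' where "a' = a - (\<chi> i. r / m)"
    have AB: "A \<subseteq> cbox a' (a' + (\<chi> i. 2 * r / m))"
    proof
      fix w assume w: "w \<in> A"
      have "m * dist a w \<le> dist (\<phi> a) (\<phi> w)" using lo \<rho>b w a2 by (simp add: A_def)
      also have "\<dots> < r" using w a by (simp add: A_def)
      finally have "norm (w - a) \<le> r / m"
        using mL by (simp add: dist_norm norm_minus_commute pos_le_divide_eq mult.commute)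
      then have "\<bar>w $ i - a $ i\<bar> \<le> r / m" for i
        using component_le_norm_cart[of "w - a" i] by simp
      then show "w \<in> cbox a' (a' + (\<chi> i. 2 * r / m))"
        by (auto simp: mem_box_cart a'_def abs_le_iff algebra_simps)
    qed
    have "emeasure \<mu> (M \<inter> ball x r) \<le> ennreal (2 * J) * emeasure lborel A"
      unfolding AM using Jb by (intro chart_volume_bounds(1)[OF vol ch As AVH]) (auto simp: A_def)
    also have "\<dots> \<le> ennreal (2 * J) * emeasure lborel (cbox a' (a' + (\<chi> i. 2 * r / m)))"
      by (intro mult_left_mono emeasure_mono AB) auto
    also have "\<dots> = ennreal (2 * J) * ennreal ((2 * r / m) ^ ?k)"
      using r mL by (subst emeasure_lborel_vec_cbox) auto
    also have "\<dots> = ennreal (2 * J * (2 * r / m) ^ ?k)"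
      using J r mL by (intro ennreal_mult[symmetric]) auto
    also have "2 * J * (2 * r / m) ^ ?k = C * r ^ ?k"
      by (simp add: C_def power_divide power_mult_distrib)
    finally show ?thesis using 1 by blast
  qed
  moreover have "c > 0" "C > 0" using J mL by (simp_all add: c_def C_def)
  ultimately show ?thesis using e(1) by (metis IntE mem_ball)
qed

lemma volume_measure_ball_bounds:
  fixes M :: "(real^'d) set"
  assumes mf: "smooth_submanifold_with_boundary TYPE('k::finite) M"
    and vol: "is_volume_measure TYPE('k) M \<mu>" and cM: "compact M"
  obtains e c C where "0 < e" "0 < c" "0 < C"
    "\<And>x r. x \<in> M \<Longrightarrow> 0 < r \<Longrightarrow> r < e \<Longrightarrow> ennreal (c * r ^ CARD('k)) \<le> emeasure \<mu> (M \<inter> ball x r)"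
    "\<And>x r. x \<in> M \<Longrightarrow> 0 < r \<Longrightarrow> r < e \<Longrightarrow> emeasure \<mu> (M \<inter> ball x r) \<le> ennreal (C * r ^ CARD('k))"
proof -
  let ?P = "\<lambda>p e c C. e > 0 \<and> c > 0 \<and> C > 0 \<and> (\<forall>x\<in>M \<inter> ball p e. \<forall>r. 0 < r \<and> r < e \<longrightarrow>
    ennreal (c * r ^ CARD('k)) \<le> emeasure \<mu> (M \<inter> ball x r) \<and>
    emeasure \<mu> (M \<inter> ball x r) \<le> ennreal (C * r ^ CARD('k)))"
  have "\<forall>p\<in>M. \<exists>e c C. ?P p e c C"
    using volume_measure_ball_bounds_local[OF mf vol compact_imp_closed[OF cM]] by blast
  then obtain e c C where P: "\<And>p. p \<in> M \<Longrightarrow> ?P p (e p) (c p) (C p)" by metis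
  have "M \<subseteq> (\<Union>p\<in>M. ball p (e p))" using P by force
  then obtain S where S: "S \<subseteq> M" "finite S" "M \<subseteq> (\<Union>p\<in>S. ball p (e p))"
    using compactE_image[OF cM, of M "\<lambda>p. ball p (e p)"] by auto
  \<comment> \<open>The inserted 1 keeps \<open>Min\<close> and \<open>Max\<close> meaningful when
    the finite cover is empty, that is, for empty \<open>M\<close>.\<close>
  define e0 where "e0 = Min (insert 1 (e ` S))"
  define c0 where "c0 = Min (insert 1 (c ` S))"
  define C0 where "C0 = Max (insert 1 (C ` S))"
  have pos: "0 < e0" "0 < c0" "0 < C0"
    using S P by (auto simp: e0_def c0_def C0_def Max_gr_iff)
  have b: "ennreal (c0 * r ^ CARD('k)) \<le> emeasure \<mu> (M \<inter> ball x r) \<and>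
    emeasure \<mu> (M \<inter> ball x r) \<le> ennreal (C0 * r ^ CARD('k))"
    if x: "x \<in> M" and r: "0 < r" "r < e0" for x r
  proof -
    obtain p where p: "p \<in> S" "x \<in> ball p (e p)" using S x by blast
    have le: "e0 \<le> e p" "c0 \<le> c p" "C p \<le> C0"
      using S p by (auto simp: e0_def c0_def C0_def)
    have "ennreal (c p * r ^ CARD('k)) \<le> emeasure \<mu> (M \<inter> ball x r)"
      "emeasure \<mu> (M \<inter> ball x r) \<le> ennreal (C p * r ^ CARD('k))"
      using P[of p] p S x r le by auto
    moreover have "ennreal (c0 * r ^ CARD('k)) \<le> ennreal (c p * r ^ CARD('k))"
      "ennreal (C p * r ^ CARD('k)) \<le> ennreal (C0 * r ^ CARD('k))"
      using le r by (auto intro!: ennreal_leI mult_right_mono)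
    ultimately show ?thesis by (meson order_trans)
  qed
  show ?thesis using that[OF pos] b by blast
qed

text \<open>Finiteness is not built into \<open>is_volume_measure\<close>; it follows from a finite
  cover by balls of controlled volume. Fubini and the integrability of square-integrable functions
  rest on it.\<close>

lemma volume_measure_finite:
  fixes M :: "(real^'d) set"
  assumes mf: "smooth_submanifold_with_boundary TYPE('k::finite) M"
    and vol: "is_volume_measure TYPE('k) M \<mu>" and cM: "compact M"
  shows "finite_measure \<mu>"
proof -
  obtain e C where e: "0 < e"
    and b: "\<And>x r. x \<in> M \<Longrightarrow> 0 < r \<Longrightarrow> r < e \<Longrightarrow> emeasure \<mu> (M \<inter> ball x r) \<le> ennreal (C * r ^ CARD('k))"
    using volume_measure_ball_bounds[OF mf vol cM] by metis
  have st: "sets \<mu> = sets (restrict_space borel M)"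
    using vol by (simp add: is_volume_measure_def)
  then have sp: "space \<mu> = M" by (auto dest: sets_eq_imp_space_eq simp: space_restrict_space)
  have "M \<subseteq> (\<Union>p\<in>M. ball p (e / 2))" using e by force
  then obtain S where S: "S \<subseteq> M" "finite S" "M \<subseteq> (\<Union>p\<in>S. ball p (e / 2))"
    using compactE_image[OF cM, of M "\<lambda>p. ball p (e / 2)"] by auto
  have in_sets: "M \<inter> ball p (e / 2) \<in> sets \<mu>" for p
    unfolding st by (auto simp: sets_restrict_space)
  have "M = (\<Union>p\<in>S. M \<inter> ball p (e / 2))" using S by blast
  then have "emeasure \<mu> M = emeasure \<mu> (\<Union>p\<in>S. M \<inter> ball p (e / 2))" by metis
  also have "\<dots> \<le> (\<Sum>p\<in>S. emeasure \<mu> (M \<inter> ball p (e / 2)))"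
    using S(2) in_sets by (intro emeasure_subadditive_finite) auto
  also have "\<dots> \<le> (\<Sum>p\<in>S. ennreal (C * (e / 2) ^ CARD('k)))"
    using S(1) e by (intro sum_mono b) auto
  also have "\<dots> < \<infinity>" by (simp add: ennreal_mult_less_top of_nat_less_top)
  finally show ?thesis by (intro finite_measureI) (simp add: sp)
qed

subsection \<open>Kernel and gradient estimates\<close>

lemma derivative_zero_on_tail:
  fixes f :: "real \<Rightarrow> real"
  assumes d: "(f has_real_derivative d) (at r within {0..})" and z: "\<And>s. s > 1 \<Longrightarrow> f s = 0" and r: "r > 1"
  shows "d = 0"
proof -
  have "at r within {0..} = at r"
    using r by (intro at_within_open_subset[of _ "{1<..}"]) auto
  then have "(f has_real_derivative d) (at r)" using d by simp
  moreover have "(f has_real_derivative 0) (at r)"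
    by (rule has_field_derivative_transform_within_open[of "\<lambda>_. 0" 0 r "{1<..}"])
      (use r z in auto)
  ultimately show ?thesis by (rule DERIV_unique)
qed

lemma bounded_if_zero_on_tail:
  fixes f :: "real \<Rightarrow> real"
  assumes c: "continuous_on {0..} f" and z: "\<And>r. r > 1 \<Longrightarrow> f r = 0"
  obtains B where "B > 0" "\<And>r. r \<ge> 0 \<Longrightarrow> \<bar>f r\<bar> \<le> B"
proof -
  have "compact (f ` {0..1})"
    by (intro compact_continuous_image continuous_on_subset[OF c]) auto
  then obtain B where B: "B > 0" "\<And>r. r \<in> {0..1} \<Longrightarrow> norm (f r) \<le> B"
    using compact_imp_bounded bounded_pos by (metis image_eqI)
  show ?thesis
  proof (rule that[OF B(1)])
    show "\<bar>f r\<bar> \<le> B" if "r \<ge> 0" for r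
      using that B z[of r] by (cases "r > 1") auto
  qed
qed

text \<open>Two applications of the mean value inequality, first to \<open>f'\<close> and then to
  \<open>f\<close> minus its linear part. The constant is \<open>B\<close> instead of the sharp
  \<open>B / 2\<close>, and derivatives within \<open>{0..}\<close> suffice, including the one-sided
  one at 0.\<close>

lemma taylor_remainder_le:
  fixes f f' f'' :: "real \<Rightarrow> real"
  assumes f: "\<And>r. r \<ge> 0 \<Longrightarrow> (f has_real_derivative f' r) (at r within {0..})"
    and f': "\<And>r. r \<ge> 0 \<Longrightarrow> (f' has_real_derivative f'' r) (at r within {0..})"
    and B: "\<And>r. r \<ge> 0 \<Longrightarrow> \<bar>f'' r\<bar> \<le> B" and rs: "r \<ge> 0" "s \<ge> 0"
  shows "\<bar>f s - f r - f' r * (s - r)\<bar> \<le> B * (s - r)\<^sup>2"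
proof -
  let ?S = "closed_segment r s"
  have S: "?S \<subseteq> {0..}" using rs by (auto simp: closed_segment_eq_real_ivl)
  have d: "\<bar>f' a - f' r\<bar> \<le> B * \<bar>s - r\<bar>" if a: "a \<in> ?S" for a
  proof -
    have "norm (f' a - f' r) \<le> B * norm (a - r)"
      by (rule field_differentiable_bound[of "{0..}" f' f'']) (use f' B rs S a in auto)
    also have "\<dots> \<le> B * \<bar>s - r\<bar>"
      using a B[of 0] by (intro mult_left_mono) (auto simp: closed_segment_eq_real_ivl split: if_splits)
    finally show ?thesis by simp
  qed
  have "norm ((f s - f' r * s) - (f r - f' r * r)) \<le> (B * \<bar>s - r\<bar>) * norm (s - r)"
  proof (rule field_differentiable_bound[of ?S "\<lambda>a. f a - f' r * a" "\<lambda>a. f' a - f' r"])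
    fix a assume a: "a \<in> ?S"
    then have "a \<ge> 0" using S by auto
    then have "(f has_real_derivative f' a) (at a within ?S)"
      using f S has_field_derivative_subset by blast
    then show "((\<lambda>a. f a - f' r * a) has_real_derivative f' a - f' r) (at a within ?S)"
      by (auto intro!: derivative_eq_intros)
    show "norm (f' a - f' r) \<le> B * \<bar>s - r\<bar>" using d[OF a] by simp
  qed auto
  then show ?thesis by (simp add: algebra_simps power2_eq_square abs_mult_self_eq flip: abs_mult)
qed

text \<open>The inequality between \<open>R'\<close> and \<open>R\<close> comes from the
  nonnegativity of \<open>R\<close> at the minimiser of a Taylor majorant. On a half line that
  minimiser might be negative, where nothing is known about \<open>R\<close>. For
  \<open>r > 1/2\<close> this cannot happen, because the shift is at most 1/2; for
  \<open>r \<le> 1/2\<close> the lower bound \<open>\<delta>\<close> on \<open>R\<close> and the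
  boundedness of \<open>R'\<close> give the inequality directly.\<close>

lemma kernel_ok_bounds:
  assumes "kernel_ok R"
  obtains R' A B \<delta> where "A > 0" "B > 0" "\<delta> > 0"
    "continuous_on {0..} R" "continuous_on {0..} R'"
    "\<And>r. r \<ge> 0 \<Longrightarrow> 0 \<le> R r" "\<And>r. r \<ge> 0 \<Longrightarrow> R r \<le> B" "\<And>r. r \<ge> 0 \<Longrightarrow> \<bar>R' r\<bar> \<le> B"
    "\<And>r. r > 1 \<Longrightarrow> R r = 0"
    "\<And>r. r \<ge> 0 \<Longrightarrow> (R' r)\<^sup>2 \<le> A * R r"
    "\<And>r s. r \<ge> 0 \<Longrightarrow> s \<ge> 0 \<Longrightarrow> \<bar>R s - R r - R' r * (s - r)\<bar> \<le> B * (s - r)\<^sup>2"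
    "\<And>r. 0 \<le> r \<Longrightarrow> r \<le> 1/2 \<Longrightarrow> \<delta> \<le> R r"
proof -
  obtain R' R'' where
    d: "\<forall>r\<ge>0. (R has_real_derivative R' r) (at r within {0..}) \<and>
            (R' has_real_derivative R'' r) (at r within {0..})" and
    c2: "continuous_on {0..} R''"
    using assms unfolding kernel_ok_def by (elim conjE exE) (rule that)
  obtain \<delta> where \<delta>0: "\<delta> > 0" "\<forall>r. 0 \<le> r \<and> r \<le> 1/2 \<longrightarrow> R r \<ge> \<delta>"
    using assms unfolding kernel_ok_def by (elim conjE bexE exE) (rule that)
  have d1: "(R has_real_derivative R' r) (at r within {0..})"
    and d2: "(R' has_real_derivative R'' r) (at r within {0..})" if "r \<ge> 0" for r
    using d that by simp_all
  have nn: "R r \<ge> 0" if "r \<ge> 0" for r using assms that by (simp add: kernel_ok_def)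
  have z: "R r = 0" if "r > 1" for r using assms that by (simp add: kernel_ok_def)
  have \<delta>: "\<delta> > 0" "\<And>r. 0 \<le> r \<Longrightarrow> r \<le> 1/2 \<Longrightarrow> R r \<ge> \<delta>" using \<delta>0 by simp_all
  have z1: "R' r = 0" if "r > 1" for r
    using derivative_zero_on_tail[OF d1 z that] that by simp
  have z2: "R'' r = 0" if "r > 1" for r
    using derivative_zero_on_tail[OF d2 z1 that] that by simp
  have c0: "continuous_on {0..} R" and c1: "continuous_on {0..} R'"
    using d1 d2 by (auto intro!: DERIV_continuous_on)
  obtain B0 where B0: "B0 > 0" "\<And>r. r \<ge> 0 \<Longrightarrow> \<bar>R r\<bar> \<le> B0" using bounded_if_zero_on_tail[OF c0 z] by blast
  obtain B1 where B1: "B1 > 0" "\<And>r. r \<ge> 0 \<Longrightarrow> \<bar>R' r\<bar> \<le> B1" using bounded_if_zero_on_tail[OF c1 z1] by blast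
  obtain B2 where B2: "B2 > 0" "\<And>r. r \<ge> 0 \<Longrightarrow> \<bar>R'' r\<bar> \<le> B2" using bounded_if_zero_on_tail[OF c2 z2] by blast
  \<comment> \<open>One constant for \<open>R\<close>, \<open>R'\<close> and \<open>R''\<close>.
    Since it bounds the second derivative and also dominates \<open>R'\<close>, the shift
    \<open>R' r / (2 * B)\<close> is at most 1/2 in absolute value.\<close>
  define B where "B = B0 + B1 + B2"
  have B: "B > 0" "B0 \<le> B" "B1 \<le> B" "B2 \<le> B" using B0 B1 B2 by (auto simp: B_def)
  have T: "\<bar>R s - R r - R' r * (s - r)\<bar> \<le> B * (s - r)\<^sup>2" if "r \<ge> 0" "s \<ge> 0" for r s
    using taylor_remainder_le[OF d1 d2 _ that, of B] B2 B by (meson order_trans)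
  have sq: "(R' r)\<^sup>2 \<le> max (4 * B) (B\<^sup>2 / \<delta>) * R r" if r: "r \<ge> 0" for r
  proof (cases "r \<le> 1/2")
    case True
    have "(R' r)\<^sup>2 \<le> B\<^sup>2"
      using B1(2)[OF r] B by (intro abs_le_square_iff[THEN iffD1]) auto
    also have "\<dots> \<le> B\<^sup>2 / \<delta> * R r"
      using \<delta>(1) \<delta>(2)[OF r True] by (simp add: pos_le_divide_eq mult_left_mono)
    also have "\<dots> \<le> max (4 * B) (B\<^sup>2 / \<delta>) * R r"
      by (intro mult_right_mono nn r) auto
    finally show ?thesis .
  next
    case False
    \<comment> \<open>\<^term>\<open>s\<close> minimises the Taylor majorant of \<^term>\<open>R\<close> around \<^term>\<open>r\<close>, which must stay nonnegative.\<close>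
    define s where "s = r - R' r / (2 * B)"
    have "\<bar>R' r\<bar> \<le> B" using B1(2)[OF r] B by simp
    then have "\<bar>R' r / (2 * B)\<bar> \<le> 1/2" using B(1) by (simp add: abs_divide pos_divide_le_eq)
    then have "R' r / (2 * B) \<le> 1/2" by (rule abs_le_D1)
    then have s: "s \<ge> 0" using False unfolding s_def by linarith
    have "0 \<le> R s" by (rule nn[OF s])
    also have "R s \<le> R r + R' r * (s - r) + B * (s - r)\<^sup>2"
      using T[OF r s] by (simp add: abs_le_iff)
    also have "\<dots> = R r - (R' r)\<^sup>2 / (4 * B)"
      using B(1) by (simp add: s_def power2_eq_square field_simps)
    finally have "(R' r)\<^sup>2 \<le> 4 * B * R r"
      using B(1) by (simp add: pos_divide_le_eq mult.commute)
    also have "\<dots> \<le> max (4 * B) (B\<^sup>2 / \<delta>) * R r"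
      by (intro mult_right_mono nn r) auto
    finally show ?thesis .
  qed
  show ?thesis
  proof (rule that[of "max (4 * B) (B\<^sup>2 / \<delta>)" B \<delta> R'])
    show "R r \<le> B" "\<bar>R' r\<bar> \<le> B" if "r \<ge> 0" for r
      using B0(2)[OF that] B1(2)[OF that] B by auto
  qed (use B \<delta> c0 c1 nn z sq T in auto)
qed

section \<open>Ambient and intrinsic gradients\<close>

lemma norm_ambient_grad_le:
  fixes f :: "real^'d \<Rightarrow> real"
  assumes d: "(f has_derivative D) (at x)" and L: "\<And>h. (D h)\<^sup>2 \<le> L * (norm h)\<^sup>2"
  shows "(norm (ambient_grad f x))\<^sup>2 \<le> L"
proof -
  let ?G = "ambient_grad f x"
  have D: "frechet_derivative f (at x) = D"
    using frechet_derivative_at[OF d] by simp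
  have lin: "linear D" using d by (rule has_derivative_linear)
  \<comment> \<open>The derivative is tested on the gradient itself, where it equals the squared
    norm; one factor of that square then cancels.\<close>
  have "D ?G = (\<Sum>b\<in>Basis. D b * D b)"
    unfolding ambient_grad_def D by (simp add: linear_sum[OF lin] linear_scale[OF lin])
  also have "\<dots> = ?G \<bullet> ?G"
    unfolding ambient_grad_def D
    by (simp add: inner_sum_right inner_sum_left inner_Basis if_distrib sum.delta cong: if_cong)
  finally have "((norm ?G)\<^sup>2)\<^sup>2 \<le> L * (norm ?G)\<^sup>2"
    using L[of ?G] by (simp add: power2_norm_eq_inner)
  then have "(norm ?G)\<^sup>2 * (norm ?G)\<^sup>2 \<le> L * (norm ?G)\<^sup>2" by (simp add: power2_eq_square)
  moreover have "0 \<le> L" using L[of "axis undefined 1"] by (simp add: norm_axis_1) (smt (verit) zero_le_power2)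
  ultimately show ?thesis
    using mult_right_le_imp_le[of "(norm ?G)\<^sup>2" "(norm ?G)\<^sup>2" L] by (cases "?G = 0") simp_all
qed

text \<open>\<open>tangent_space\<close> is a choice among the tangent images of charts at
  \<open>x\<close>. Whichever is chosen is a linear subspace, and the closest-point projection onto
  it is 1-Lipschitz and fixes 0.\<close>

lemma norm_mgrad_le:
  fixes M :: "(real^'d) set"
  assumes mf: "smooth_submanifold_with_boundary TYPE('k::finite) M" and x: "x \<in> M"
  shows "norm (mgrad TYPE('k) M f x) \<le> norm (ambient_grad f x)"
proof -
  let ?P = "\<lambda>T. \<exists>(\<phi>::real^'k \<Rightarrow> real^'d) V H z. is_chart M \<phi> V H \<and> z \<in> V \<inter> H \<and> \<phi> z = x \<and>
        T = range (frechet_derivative \<phi> (at z))"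
  obtain \<phi> :: "real^'k \<Rightarrow> real^'d" and V H where "is_chart M \<phi> V H" "x \<in> \<phi> ` (V \<inter> H)"
    using mf x unfolding smooth_submanifold_with_boundary_def by meson
  then obtain z where "is_chart M \<phi> V H" "z \<in> V \<inter> H" "\<phi> z = x" by blast
  then have "?P (range (frechet_derivative \<phi> (at z)))"
    by (intro exI[of _ \<phi>] exI[of _ V] exI[of _ H] exI[of _ z] conjI refl)
  then have "?P (SOME T. ?P T)"
    by (rule someI[of ?P])
  then have "?P (tangent_space TYPE('k) M x)"
    unfolding tangent_space_def .
  then obtain \<phi> :: "real^'k \<Rightarrow> real^'d" and V H z where ch: "is_chart M \<phi> V H" and z: "z \<in> V \<inter> H"
    and T: "tangent_space TYPE('k) M x = range (frechet_derivative \<phi> (at z))"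
    by (elim exE conjE) (rule that)
  have "smooth_on V \<phi>" using ch by (simp add: is_chart_def)
  then have "\<phi> differentiable (at z)" using z unfolding smooth_on_def by (metis IntD1 dderiv.simps(1))
  then have "linear (frechet_derivative \<phi> (at z))"
    by (rule linear_frechet_derivative)
  then have sub: "subspace (tangent_space TYPE('k) M x)"
    unfolding T by (simp add: linear_subspace_image)
  then have "dist (closest_point (tangent_space TYPE('k) M x) (ambient_grad f x))
      (closest_point (tangent_space TYPE('k) M x) 0) \<le> dist (ambient_grad f x) 0"
    by (intro closest_point_lipschitz closed_subspace subspace_imp_convex)
      (auto dest: subspace_0)
  then show ?thesis
    using closest_point_self[OF subspace_0[OF sub]] by (simp add: mgrad_def)
qed

section \<open>Cauchy-Schwarz, a differentiability criterion, and symmetrisation\<close>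

lemma integral_Cauchy_Schwarz:
  fixes f g :: "'a \<Rightarrow> real"
  assumes f: "integrable M (\<lambda>x. (f x)\<^sup>2)" and g: "integrable M (\<lambda>x. (g x)\<^sup>2)"
    and fg: "integrable M (\<lambda>x. f x * g x)"
  shows "(\<integral>x. f x * g x \<partial>M)\<^sup>2 \<le> (\<integral>x. (f x)\<^sup>2 \<partial>M) * (\<integral>x. (g x)\<^sup>2 \<partial>M)"
proof -
  let ?a = "\<integral>x. (f x)\<^sup>2 \<partial>M" and ?b = "\<integral>x. f x * g x \<partial>M" and ?c = "\<integral>x. (g x)\<^sup>2 \<partial>M"
  have q: "0 \<le> ?a * s\<^sup>2 + 2 * s * ?b + ?c" for s
  proof -
    have "0 \<le> (\<integral>x. (s * f x + g x)\<^sup>2 \<partial>M)" by simp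
    also have "\<dots> = (\<integral>x. s\<^sup>2 * (f x)\<^sup>2 + (2 * s) * (f x * g x) + (g x)\<^sup>2 \<partial>M)"
      by (intro Bochner_Integration.integral_cong) (auto simp: power2_eq_square algebra_simps)
    also have "\<dots> = s\<^sup>2 * ?a + (2 * s) * ?b + ?c"
      using f g fg by simp
    finally show ?thesis by (simp add: mult.commute)
  qed
  have ac: "0 \<le> ?a" "0 \<le> ?c" by simp_all
  show ?thesis
  proof (cases "?a = 0")
    case True
    have "?b = 0"
    proof (rule ccontr)
      assume "?b \<noteq> 0"
      \<comment> \<open>At this value of \<open>s\<close> the remaining expression
        \<open>2 * s * ?b + ?c\<close> equals -1.\<close>
      then show False using q[of "- (?c + 1) / (2 * ?b)"] True by (simp add: field_simps)
    qed
    then show ?thesis using True by simp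
  next
    case False
    then have a: "?a > 0" using ac(1) by linarith
    have "0 \<le> ?a * (- ?b / ?a)\<^sup>2 + 2 * (- ?b / ?a) * ?b + ?c" by (rule q)
    also have "\<dots> = ?c - ?b\<^sup>2 / ?a" using a by (simp add: field_simps power2_eq_square)
    finally show ?thesis using a by (simp add: pos_divide_le_eq mult.commute)
  qed
qed

lemma has_derivative_if_quadratic_remainder:
  fixes f :: "'a::euclidean_space \<Rightarrow> 'b::real_normed_vector"
  assumes lin: "linear D" and d: "d > 0"
    and q: "\<And>h. norm h < d \<Longrightarrow> norm (f (x + h) - f x - D h) \<le> C * (norm h)\<^sup>2"
  shows "(f has_derivative D) (at x)"
  unfolding has_derivative_at
proof
  show "bounded_linear D" using lin by (rule linear_conv_bounded_linear[THEN iffD1])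
  show "(\<lambda>h. norm (f (x + h) - f x - D h) / norm h) \<midarrow>0\<rightarrow> 0"
  proof (rule real_tendsto_sandwich[where f = "\<lambda>_. 0" and h = "\<lambda>h. C * norm h"])
    have "\<forall>\<^sub>F h in at 0. norm h < d"
      using d by (auto simp: eventually_at)
    then show "\<forall>\<^sub>F h in at 0. norm (f (x + h) - f x - D h) / norm h \<le> C * norm h"
    proof eventually_elim
      case (elim h)
      then show ?case using q[of h]
        by (cases "h = 0") (auto simp: pos_divide_le_eq power2_eq_square mult.assoc)
    qed
    show "((\<lambda>h. C * norm h) \<longlongrightarrow> 0) (at (0::'a))"
      by (auto intro!: tendsto_eq_intros)
  qed auto
qed

text \<open>Exchanging the variables in \<open>F x y = K x y * u x * (u x - u y)\<close> preserves
  its integral, and \<open>F x y + F y x\<close> is the squared difference weighted by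
  \<open>K\<close>. Fubini is legitimate because on a finite measure space
  \<open>(u x)\<^sup>2\<close> and \<open>(u y)\<^sup>2\<close> are integrable over the product and
  together dominate \<open>F\<close>.\<close>

lemma (in finite_measure) double_integral_symmetric_difference:
  fixes K :: "'a \<Rightarrow> 'a \<Rightarrow> real"
  assumes Km: "case_prod K \<in> borel_measurable (M \<Otimes>\<^sub>M M)"
    and Kb: "\<And>x y. \<bar>K x y\<bar> \<le> B" and sym: "\<And>x y. K x y = K y x"
    and um[measurable]: "u \<in> borel_measurable M" and u2: "integrable M (\<lambda>x. (u x)\<^sup>2)"
  shows "integrable M (\<lambda>x. \<integral>y. K x y * (u x - u y)\<^sup>2 \<partial>M)"
    and "(\<integral>x. u x * (\<integral>y. K x y * (u x - u y) \<partial>M) \<partial>M)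
      = (1/2) * (\<integral>x. \<integral>y. K x y * (u x - u y)\<^sup>2 \<partial>M \<partial>M)"
proof -
  interpret P: pair_sigma_finite M M ..
  note Km[measurable]
  define F where "F x y = K x y * u x * (u x - u y)" for x y
  have "integrable (M \<Otimes>\<^sub>M M) (\<lambda>p. (u (fst p))\<^sup>2)"
    by (rule P.Fubini_integrable) (use u2 in \<open>auto simp: mult.commute\<close>)
  moreover from P.integrable_product_swap[OF this]
  have "integrable (M \<Otimes>\<^sub>M M) (\<lambda>p. (u (snd p))\<^sup>2)"
    by (simp add: case_prod_beta')
  ultimately have dom: "integrable (M \<Otimes>\<^sub>M M) (\<lambda>p. B * (2 * (u (fst p))\<^sup>2 + (u (snd p))\<^sup>2))"
    by auto
  have FI: "integrable (M \<Otimes>\<^sub>M M) (\<lambda>p. F (fst p) (snd p))"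
  proof (rule Bochner_Integration.integrable_bound[OF dom])
    have "(\<lambda>p. K (fst p) (snd p)) \<in> borel_measurable (M \<Otimes>\<^sub>M M)"
      using Km by (simp add: case_prod_beta')
    then show "(\<lambda>p. F (fst p) (snd p)) \<in> borel_measurable (M \<Otimes>\<^sub>M M)"
      unfolding F_def by measurable
    have "\<bar>F a b\<bar> \<le> B * (2 * (u a)\<^sup>2 + (u b)\<^sup>2)" for a b
    proof -
      have "\<bar>u a * (u a - u b)\<bar> \<le> 2 * (u a)\<^sup>2 + (u b)\<^sup>2"
      proof -
        have "\<bar>u a * (u a - u b)\<bar> \<le> (u a)\<^sup>2 + \<bar>u a * u b\<bar>"
          using abs_triangle_ineq4[of "(u a)\<^sup>2" "u a * u b"]
          by (simp add: right_diff_distrib power2_eq_square)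
        moreover have "2 * \<bar>u a * u b\<bar> \<le> (u a)\<^sup>2 + (u b)\<^sup>2"
          using sum_squares_bound[of "\<bar>u a\<bar>" "\<bar>u b\<bar>"] by (simp add: abs_mult mult.assoc)
        ultimately show ?thesis
          using zero_le_power2[of "u a"] zero_le_power2[of "u b"] by linarith
      qed
      then have "\<bar>K a b\<bar> * \<bar>u a * (u a - u b)\<bar> \<le> B * (2 * (u a)\<^sup>2 + (u b)\<^sup>2)"
        using Kb[of a b] by (intro mult_mono) auto
      then show ?thesis by (simp add: F_def abs_mult mult.assoc)
    qed
    then show "AE p in M \<Otimes>\<^sub>M M. norm (F (fst p) (snd p)) \<le> norm (B * (2 * (u (fst p))\<^sup>2 + (u (snd p))\<^sup>2))"
      by (intro AE_I2) (simp add: order_trans[OF _ abs_ge_self])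
  qed
  have FI': "integrable (M \<Otimes>\<^sub>M M) (case_prod F)"
    using FI by (simp add: case_prod_beta')
  have FI2: "integrable (M \<Otimes>\<^sub>M M) (\<lambda>(x, y). F y x)"
    using P.integrable_product_swap[OF FI'] by (simp add: case_prod_beta')
  have sumF: "F x y + F y x = K x y * (u x - u y)\<^sup>2" for x y
    unfolding F_def using sym[of y x] by (simp add: power2_eq_square algebra_simps)
  have SI: "integrable (M \<Otimes>\<^sub>M M) (\<lambda>(x, y). K x y * (u x - u y)\<^sup>2)"
    using Bochner_Integration.integrable_add[OF FI' FI2] by (simp add: case_prod_beta' sumF)
  show "integrable M (\<lambda>x. \<integral>y. K x y * (u x - u y)\<^sup>2 \<partial>M)"
    using P.integrable_fst'[OF SI] by simp
  have "(\<integral>x. \<integral>y. K x y * (u x - u y)\<^sup>2 \<partial>M \<partial>M) = (\<integral>p. (case p of (x, y) \<Rightarrow> K x y * (u x - u y)\<^sup>2) \<partial>(M \<Otimes>\<^sub>M M))"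
    using P.integral_fst'[OF SI] by simp
  also have "\<dots> = (\<integral>p. case_prod F p + (case p of (x, y) \<Rightarrow> F y x) \<partial>(M \<Otimes>\<^sub>M M))"
    by (intro Bochner_Integration.integral_cong) (auto simp: sumF)
  also have "\<dots> = (\<integral>p. case_prod F p \<partial>(M \<Otimes>\<^sub>M M)) + (\<integral>p. (case p of (x, y) \<Rightarrow> F y x) \<partial>(M \<Otimes>\<^sub>M M))"
    by (rule Bochner_Integration.integral_add[OF FI' FI2])
  also have "(\<integral>p. (case p of (x, y) \<Rightarrow> F y x) \<partial>(M \<Otimes>\<^sub>M M)) = (\<integral>p. case_prod F p \<partial>(M \<Otimes>\<^sub>M M))"
    using P.integral_product_swap[of "case_prod F"] FI' by (simp add: case_prod_beta')
  also have "(\<integral>p. case_prod F p \<partial>(M \<Otimes>\<^sub>M M)) = (\<integral>x. \<integral>y. F x y \<partial>M \<partial>M)"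
    using P.integral_fst'[OF FI'] by simp
  also have "(\<lambda>x. \<integral>y. F x y \<partial>M) = (\<lambda>x. u x * (\<integral>y. K x y * (u x - u y) \<partial>M))"
    unfolding F_def by (simp add: mult.assoc mult.left_commute)
  finally show "(\<integral>x. u x * (\<integral>y. K x y * (u x - u y) \<partial>M) \<partial>M)
      = (1/2) * (\<integral>x. \<integral>y. K x y * (u x - u y)\<^sup>2 \<partial>M \<partial>M)" by simp
qed

lemma integrable_mult_bounded:
  fixes f g :: "'a \<Rightarrow> real"
  assumes "integrable M f" "g \<in> borel_measurable M" "\<And>x. x \<in> space M \<Longrightarrow> \<bar>g x\<bar> \<le> c"
  shows "integrable M (\<lambda>x. g x * f x)"
proof (rule Bochner_Integration.integrable_bound)
  show "integrable M (\<lambda>x. c * f x)" using assms by simp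
  have "\<bar>g x\<bar> \<le> \<bar>c\<bar>" if "x \<in> space M" for x
    using assms(3)[OF that] by simp
  then show "AE x in M. norm (g x * f x) \<le> norm (c * f x)"
    by (intro AE_I2) (simp add: abs_mult mult_right_mono)
qed (use assms in auto)

section \<open>The averaging operator at a fixed scale \<open>t\<close>\<close>

locale kernel_smoothing = finite_measure \<mu>
  for \<mu> :: "(real^'d) measure" +
  fixes M :: "(real^'d) set" and R R' :: "real \<Rightarrow> real" and A B t :: real
  assumes sets_\<mu>: "sets \<mu> = sets (restrict_space borel M)"
    and bounded_M: "bounded M"
    and t_pos: "t > 0" and A_pos: "A > 0" and B_pos: "B > 0"
    and cont_R: "continuous_on {0..} R" and cont_R': "continuous_on {0..} R'"
    and R_nonneg: "\<And>r. r \<ge> 0 \<Longrightarrow> 0 \<le> R r" and R_le: "\<And>r. r \<ge> 0 \<Longrightarrow> R r \<le> B"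
    and R'_le: "\<And>r. r \<ge> 0 \<Longrightarrow> \<bar>R' r\<bar> \<le> B"
    and R_zero: "\<And>r. r > 1 \<Longrightarrow> R r = 0"
    and R'_square_le: "\<And>r. r \<ge> 0 \<Longrightarrow> (R' r)\<^sup>2 \<le> A * R r"
    and R_taylor: "\<And>r s. r \<ge> 0 \<Longrightarrow> s \<ge> 0 \<Longrightarrow> \<bar>R s - R r - R' r * (s - r)\<bar> \<le> B * (s - r)\<^sup>2"
begin

text \<open>The factor \<open>Ct\<close> is left out: it cancels in the quotient defining
  \<open>v\<close> and returns only in the final count of powers of \<open>t\<close>.\<close>

definition K :: "real^'d \<Rightarrow> real^'d \<Rightarrow> real" where
  "K x y = R ((norm (x - y))\<^sup>2 / (4 * t))"

text \<open>The chain-rule expression for the derivative of \<open>K\<close> in its first argument,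
  at \<open>x\<close> in direction \<open>h\<close>.\<close>

definition DK :: "real^'d \<Rightarrow> real^'d \<Rightarrow> real^'d \<Rightarrow> real" where
  "DK x h y = R' ((norm (x - y))\<^sup>2 / (4 * t)) * (((x - y) \<bullet> h) / (2 * t))"

lemma space_\<mu>: "space \<mu> = M"
  using sets_eq_imp_space_eq[OF sets_\<mu>] by (simp add: space_restrict_space)

lemma borel_measurable_\<mu>: "f \<in> borel_measurable borel \<Longrightarrow> f \<in> borel_measurable \<mu>"
  using measurable_restrict_space1[of f borel borel M] measurable_cong_sets[OF sets_\<mu> refl] by blast

lemma arg_nonneg: "0 \<le> (norm (x - y))\<^sup>2 / (4 * t)"
  using t_pos by simp

lemma K_nonneg: "0 \<le> K x y" and K_le: "K x y \<le> B"
  unfolding K_def using R_nonneg R_le arg_nonneg by auto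

lemma K_sym: "K x y = K y x"
  by (simp add: K_def norm_minus_commute)

lemma K_measurable: "K x \<in> borel_measurable \<mu>"
  unfolding K_def using t_pos
  by (intro borel_measurable_\<mu> borel_measurable_continuous_onI
      continuous_on_compose2[OF cont_R] continuous_intros) auto

lemma DK_measurable: "DK x h \<in> borel_measurable \<mu>"
  unfolding DK_def using t_pos
  by (intro borel_measurable_\<mu> borel_measurable_continuous_onI continuous_on_mult
      continuous_on_compose2[OF cont_R'] continuous_intros) auto

lemma K_pair_measurable: "case_prod K \<in> borel_measurable (\<mu> \<Otimes>\<^sub>M \<mu>)"
proof -
  have "(\<lambda>p. K (fst p) (snd p)) \<in> borel_measurable borel"
    unfolding K_def using t_pos
    by (intro borel_measurable_continuous_onI continuous_on_compose2[OF cont_R] continuous_intros) auto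
  moreover have "(\<lambda>p. (fst p, snd p)) \<in> measurable (\<mu> \<Otimes>\<^sub>M \<mu>) (borel :: ((real^'d) \<times> (real^'d)) measure)"
    unfolding borel_prod[symmetric]
    by (intro measurable_Pair measurable_compose[OF measurable_fst] measurable_compose[OF measurable_snd]
        borel_measurable_\<mu>) auto
  ultimately show ?thesis
    using measurable_compose by (fastforce simp: case_prod_beta')
qed

lemma norm_diff_bound: "\<exists>d\<ge>0. \<forall>y\<in>M. norm (x - y) \<le> d"
proof -
  obtain b where "\<And>y. y \<in> M \<Longrightarrow> norm y \<le> b" using bounded_M bounded_iff by metis
  then have "norm (x - y) \<le> norm x + \<bar>b\<bar>" if "y \<in> M" for y
    using that norm_triangle_ineq4[of x y] by (smt (verit))
  then show ?thesis by (intro exI[of _ "norm x + \<bar>b\<bar>"]) simp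
qed

lemma DK_bounded: "\<exists>c. \<forall>y\<in>M. \<bar>DK x h y\<bar> \<le> c"
proof -
  obtain d where d: "d \<ge> 0" "\<And>y. y \<in> M \<Longrightarrow> norm (x - y) \<le> d"
    using norm_diff_bound by blast
  have "\<bar>DK x h y\<bar> \<le> B * (d * norm h / (2 * t))" if "y \<in> M" for y
  proof -
    have "\<bar>(x - y) \<bullet> h\<bar> \<le> d * norm h"
      using Cauchy_Schwarz_ineq2[of "x - y" h] d(2)[OF that]
      by (meson mult_right_mono norm_ge_zero order_trans)
    then show ?thesis
      unfolding DK_def abs_mult using t_pos d R'_le arg_nonneg B_pos
      by (intro mult_mono) (auto simp: abs_divide divide_right_mono)
  qed
  then show ?thesis by blast
qed

lemma integrable_K: "integrable \<mu> f \<Longrightarrow> integrable \<mu> (\<lambda>y. K x y * f y)"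
  using K_nonneg K_le by (intro integrable_mult_bounded[where c = B] K_measurable) auto

lemma integrable_DK: "integrable \<mu> f \<Longrightarrow> integrable \<mu> (\<lambda>y. DK x h y * f y)"
  by (metis DK_bounded[of x h] integrable_mult_bounded[OF _ DK_measurable] space_\<mu>)

text \<open>Taylor's formula for \<open>R\<close> between the two kernel arguments \<open>a\<close>
  and \<open>b\<close>, both nonnegative, so the one-sided derivative of \<open>R\<close> at 0
  causes no trouble when \<open>x = y\<close>. Boundedness of \<open>M\<close> makes the constant
  uniform in \<open>y\<close>.\<close>

lemma K_remainder:
  "\<exists>C. \<forall>h y. norm h < 1 \<longrightarrow> y \<in> M \<longrightarrow> \<bar>K (x + h) y - K x y - DK x h y\<bar> \<le> C * (norm h)\<^sup>2"
proof -
  obtain d where d: "d \<ge> 0" "\<And>y. y \<in> M \<Longrightarrow> norm (x - y) \<le> d"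
    using norm_diff_bound by blast
  \<comment> \<open>A Lipschitz constant for the kernel argument: \<open>d / (2 * t)\<close> from
    the part linear in \<open>h\<close>, and \<open>1 / (4 * t)\<close> from the quadratic part,
    since the squared norm of \<open>h\<close> is at most its norm.\<close>
  define E where "E = d / (2 * t) + 1 / (4 * t)"
  have "\<bar>K (x + h) y - K x y - DK x h y\<bar> \<le> (B * E\<^sup>2 + B / (4 * t)) * (norm h)\<^sup>2"
    if h: "norm h < 1" and y: "y \<in> M" for h y
  proof -
    define a b where "a = (norm (x - y))\<^sup>2 / (4 * t)" and "b = (norm (x + h - y))\<^sup>2 / (4 * t)"
    have ab: "a \<ge> 0" "b \<ge> 0" using t_pos by (auto simp: a_def b_def)
    have "x + h - y = (x - y) + h" by simp
    then have "(norm (x + h - y))\<^sup>2 = (norm (x - y))\<^sup>2 + 2 * ((x - y) \<bullet> h) + (norm h)\<^sup>2"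
      by (simp only: power2_norm_eq_inner inner_add_left inner_add_right inner_commute)
    then have diff: "b - a = ((x - y) \<bullet> h) / (2 * t) + (norm h)\<^sup>2 / (4 * t)"
      using t_pos by (simp add: a_def b_def field_simps)
    have "\<bar>(x - y) \<bullet> h\<bar> \<le> d * norm h"
      using Cauchy_Schwarz_ineq2[of "x - y" h] d(2)[OF y]
      by (meson mult_right_mono norm_ge_zero order_trans)
    moreover have "(norm h)\<^sup>2 \<le> norm h"
      using h by (simp add: power2_eq_square mult_left_le)
    moreover have "\<bar>b - a\<bar> \<le> \<bar>(x - y) \<bullet> h\<bar> / (2 * t) + (norm h)\<^sup>2 / (4 * t)"
      unfolding diff using t_pos
      by (intro order_trans[OF abs_triangle_ineq]) (simp add: abs_divide)
    ultimately have "\<bar>b - a\<bar> \<le> d * norm h / (2 * t) + norm h / (4 * t)"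
      using t_pos by (smt (verit) divide_right_mono)
    then have "\<bar>b - a\<bar> \<le> E * norm h" by (simp add: E_def algebra_simps)
    then have sq: "(b - a)\<^sup>2 \<le> E\<^sup>2 * (norm h)\<^sup>2"
      by (metis abs_ge_zero power2_abs power_mono power_mult_distrib)
    have "K (x + h) y - K x y - DK x h y = (R b - R a - R' a * (b - a)) + R' a * ((norm h)\<^sup>2 / (4 * t))"
      unfolding K_def DK_def a_def[symmetric] b_def[symmetric] diff by (simp add: algebra_simps)
    also have "\<bar>\<dots>\<bar> \<le> B * (b - a)\<^sup>2 + B * ((norm h)\<^sup>2 / (4 * t))"
    proof (intro order_trans[OF abs_triangle_ineq] add_mono R_taylor ab)
      show "\<bar>R' a * ((norm h)\<^sup>2 / (4 * t))\<bar> \<le> B * ((norm h)\<^sup>2 / (4 * t))"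
        unfolding abs_mult using R'_le[OF ab(1)] t_pos by (intro mult_mono) auto
    qed
    also have "\<dots> \<le> B * (E\<^sup>2 * (norm h)\<^sup>2) + B * ((norm h)\<^sup>2 / (4 * t))"
      using sq B_pos by (intro add_right_mono mult_left_mono) auto
    finally show ?thesis by (simp add: algebra_simps)
  qed
  then show ?thesis by blast
qed

text \<open>The quadratic remainder of \<open>K\<close> is uniform in \<open>y\<close>, so it
  integrates against the absolute value of \<open>f\<close> to a quadratic remainder; no regularity
  of \<open>f\<close> beyond integrability enters. The point \<open>x\<close> may be any point of
  the ambient space.\<close>

lemma has_derivative_integral_K:
  assumes f: "integrable \<mu> f"
  shows "((\<lambda>x. \<integral>y. K x y * f y \<partial>\<mu>) has_derivative (\<lambda>h. \<integral>y. DK x h y * f y \<partial>\<mu>)) (at x)"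
proof -
  obtain C where C: "\<And>h y. norm h < 1 \<Longrightarrow> y \<in> M \<Longrightarrow> \<bar>K (x + h) y - K x y - DK x h y\<bar> \<le> C * (norm h)\<^sup>2"
    using K_remainder[of x] by blast
  have lin: "linear (\<lambda>h. \<integral>y. DK x h y * f y \<partial>\<mu>)"
  proof
    fix h1 h2 :: "real^'d"
    have "DK x (h1 + h2) y = DK x h1 y + DK x h2 y" for y
      by (simp add: DK_def inner_add_right add_divide_distrib distrib_left)
    then have "DK x (h1 + h2) y * f y = DK x h1 y * f y + DK x h2 y * f y" for y
      by (simp add: distrib_right)
    then show "(\<integral>y. DK x (h1 + h2) y * f y \<partial>\<mu>) = (\<integral>y. DK x h1 y * f y \<partial>\<mu>) + (\<integral>y. DK x h2 y * f y \<partial>\<mu>)"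
      using integrable_DK[OF f] by simp
  next
    fix r :: real and h :: "real^'d"
    have "DK x (r *\<^sub>R h) y = r * DK x h y" for y
      by (simp add: DK_def)
    then show "(\<integral>y. DK x (r *\<^sub>R h) y * f y \<partial>\<mu>) = r *\<^sub>R (\<integral>y. DK x h y * f y \<partial>\<mu>)"
      by (simp add: mult.assoc)
  qed
  show ?thesis
  proof (rule has_derivative_if_quadratic_remainder[OF lin zero_less_one])
    fix h :: "real^'d" assume h: "norm h < 1"
    have "(\<integral>y. K (x + h) y * f y \<partial>\<mu>) - (\<integral>y. K x y * f y \<partial>\<mu>) - (\<integral>y. DK x h y * f y \<partial>\<mu>)
      = (\<integral>y. K (x + h) y * f y - K x y * f y - DK x h y * f y \<partial>\<mu>)"
      using integrable_K[OF f] integrable_DK[OF f] by simp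
    also have "norm \<dots> \<le> (\<integral>y. C * (norm h)\<^sup>2 * \<bar>f y\<bar> \<partial>\<mu>)"
    proof (rule Bochner_Integration.integral_norm_bound_integral)
      show "integrable \<mu> (\<lambda>y. K (x + h) y * f y - K x y * f y - DK x h y * f y)"
        using integrable_K[OF f] integrable_DK[OF f] by simp
      show "integrable \<mu> (\<lambda>y. C * (norm h)\<^sup>2 * \<bar>f y\<bar>)" using f by simp
      fix y assume "y \<in> space \<mu>"
      then have "\<bar>K (x + h) y - K x y - DK x h y\<bar> * \<bar>f y\<bar> \<le> C * (norm h)\<^sup>2 * \<bar>f y\<bar>"
        using C[OF h] by (intro mult_right_mono) (auto simp: space_\<mu>)
      then show "norm (K (x + h) y * f y - K x y * f y - DK x h y * f y) \<le> C * (norm h)\<^sup>2 * \<bar>f y\<bar>"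
        by (simp add: abs_mult[symmetric] algebra_simps)
    qed
    also have "\<dots> = C * (\<integral>y. \<bar>f y\<bar> \<partial>\<mu>) * (norm h)\<^sup>2" by simp
    finally show "norm ((\<integral>y. K (x + h) y * f y \<partial>\<mu>) - (\<integral>y. K x y * f y \<partial>\<mu>) - (\<integral>y. DK x h y * f y \<partial>\<mu>))
      \<le> C * (\<integral>y. \<bar>f y\<bar> \<partial>\<mu>) * (norm h)\<^sup>2" .
  qed
qed

text \<open>Here the weight \<open>(R')\<^sup>2\<close> is traded for \<open>R\<close>. Of the
  denominator \<open>4 * t\<^sup>2\<close>, a factor \<open>4 * t\<close> combines with the squared
  distance into the kernel argument, which is at most 1 wherever \<open>K\<close> is nonzero; a
  single \<open>1 / t\<close> remains.\<close>

lemma DK_square_le: "(DK x h y)\<^sup>2 \<le> A * (norm h)\<^sup>2 / t * K x y"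
proof -
  let ?r = "(norm (x - y))\<^sup>2 / (4 * t)"
  have "(DK x h y)\<^sup>2 = (R' ?r)\<^sup>2 * (((x - y) \<bullet> h)\<^sup>2 / (4 * t\<^sup>2))"
    by (simp add: DK_def power_mult_distrib power_divide)
  also have "\<dots> \<le> (A * K x y) * ((norm (x - y))\<^sup>2 * (norm h)\<^sup>2 / (4 * t\<^sup>2))"
  proof (rule mult_mono)
    show "(R' ?r)\<^sup>2 \<le> A * K x y" using R'_square_le[OF arg_nonneg] by (simp add: K_def)
    show "((x - y) \<bullet> h)\<^sup>2 / (4 * t\<^sup>2) \<le> (norm (x - y))\<^sup>2 * (norm h)\<^sup>2 / (4 * t\<^sup>2)"
      using Cauchy_Schwarz_ineq[of "x - y" h] by (intro divide_right_mono) (auto simp: power2_norm_eq_inner)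
  qed (use A_pos K_nonneg in auto)
  also have "\<dots> = A * (norm h)\<^sup>2 / t * (K x y * ?r)"
    using t_pos by (simp add: power2_eq_square field_simps)
  also have "\<dots> \<le> A * (norm h)\<^sup>2 / t * K x y"
  proof (rule mult_left_mono)
    show "K x y * ?r \<le> K x y"
    proof (cases "?r > 1")
      case True
      then have "K x y = 0" unfolding K_def by (rule R_zero)
      then show ?thesis by simp
    next
      case False
      then show ?thesis using mult_left_le[of ?r "K x y"] K_nonneg[of x y] by linarith
    qed
  qed (use A_pos t_pos in auto)
  finally show ?thesis .
qed

text \<open>\<open>R\<close> vanishes once the distance exceeds \<open>2 * sqrt t\<close>; radius
  \<open>3 * sqrt t\<close> gives kernel argument at least 9/4, safely beyond 1. Vanishing then
  passes from \<open>K\<close> to \<open>DK\<close> through \<open>DK_square_le\<close>.\<close>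

lemma DK_zero:
  assumes "y \<notin> ball x (3 * sqrt t)"
  shows "DK x h y = 0"
proof -
  have "3 * sqrt t \<le> norm (x - y)" using assms by (simp add: dist_norm)
  then have "(3 * sqrt t)\<^sup>2 \<le> (norm (x - y))\<^sup>2" using t_pos by (intro power_mono) auto
  then have "1 < (norm (x - y))\<^sup>2 / (4 * t)" using t_pos by (simp add: power_mult_distrib pos_less_divide_eq)
  then have "K x y = 0" by (simp add: K_def R_zero)
  then show ?thesis using DK_square_le[of x h y] by simp
qed

text \<open>Cauchy-Schwarz against the indicator of the supporting ball instead of the constant 1,
  so that the small mass of that ball appears rather than the total mass of
  \<open>M\<close>.\<close>

lemma integral_DK_square_le:
  assumes g: "g \<in> borel_measurable \<mu>" "integrable \<mu> (\<lambda>y. (g y)\<^sup>2)"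
  shows "(\<integral>y. DK x h y * g y \<partial>\<mu>)\<^sup>2
    \<le> measure \<mu> (M \<inter> ball x (3 * sqrt t)) * (A * (norm h)\<^sup>2 / t) * (\<integral>y. K x y * (g y)\<^sup>2 \<partial>\<mu>)"
proof -
  let ?B = "M \<inter> ball x (3 * sqrt t)"
  have B: "?B \<in> sets \<mu>"
    unfolding sets_\<mu> by (auto simp: sets_restrict_space)
  have sq_le: "(DK x h y * g y)\<^sup>2 \<le> A * (norm h)\<^sup>2 / t * (K x y * (g y)\<^sup>2)" for y
    using mult_right_mono[OF DK_square_le[of x h y], of "(g y)\<^sup>2"] by (simp add: power_mult_distrib mult.assoc)
  have sqi: "integrable \<mu> (\<lambda>y. (DK x h y * g y)\<^sup>2)"
  proof (rule Bochner_Integration.integrable_bound)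
    show "integrable \<mu> (\<lambda>y. A * (norm h)\<^sup>2 / t * (K x y * (g y)\<^sup>2))"
      using integrable_K[OF g(2)] by simp
    show "(\<lambda>y. (DK x h y * g y)\<^sup>2) \<in> borel_measurable \<mu>"
      using DK_measurable g by simp
    show "AE y in \<mu>. norm ((DK x h y * g y)\<^sup>2) \<le> norm (A * (norm h)\<^sup>2 / t * (K x y * (g y)\<^sup>2))"
      using sq_le by (intro AE_I2) (simp only: real_norm_def abs_power2 order_trans[OF _ abs_ge_self])
  qed
  have gi: "integrable \<mu> g"
    by (rule square_integrable_imp_integrable[OF g])
  have ind: "indicator ?B y * (DK x h y * g y) = DK x h y * g y" if "y \<in> space \<mu>" for y
    using DK_zero[of y x h] that by (auto simp: indicator_def space_\<mu>)
  have "(\<integral>y. DK x h y * g y \<partial>\<mu>)\<^sup>2 = (\<integral>y. indicator ?B y * (DK x h y * g y) \<partial>\<mu>)\<^sup>2"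
    using ind by (metis (no_types, lifting) Bochner_Integration.integral_cong)
  also have "\<dots> \<le> (\<integral>y. (indicator ?B y)\<^sup>2 \<partial>\<mu>) * (\<integral>y. (DK x h y * g y)\<^sup>2 \<partial>\<mu>)"
  proof (rule integral_Cauchy_Schwarz)
    show "integrable \<mu> (\<lambda>y. (indicator ?B y :: real)\<^sup>2)"
      using B by (simp add: power2_eq_square indicator_inter_arith[symmetric] emeasure_eq_measure)
    show "integrable \<mu> (\<lambda>y. indicator ?B y * (DK x h y * g y))"
      using integrable_DK[OF gi, of x h] ind by (metis (no_types, lifting) Bochner_Integration.integrable_cong)
  qed (rule sqi)
  also have "(\<integral>y. (indicator ?B y :: real)\<^sup>2 \<partial>\<mu>) = measure \<mu> ?B"
    using B by (simp add: power2_eq_square indicator_inter_arith[symmetric] space_\<mu> Int_absorb2)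
  also have "measure \<mu> ?B * (\<integral>y. (DK x h y * g y)\<^sup>2 \<partial>\<mu>)
     \<le> measure \<mu> ?B * (\<integral>y. A * (norm h)\<^sup>2 / t * (K x y * (g y)\<^sup>2) \<partial>\<mu>)"
  proof (intro mult_left_mono integral_mono sqi)
    show "integrable \<mu> (\<lambda>y. A * (norm h)\<^sup>2 / t * (K x y * (g y)\<^sup>2))"
      using integrable_K[OF g(2)] by simp
  qed (rule sq_le measure_nonneg)+
  finally show ?thesis by (simp add: mult.assoc)
qed

text \<open>Cauchy-Schwarz after splitting the weight \<open>K\<close> into two square
  roots.\<close>

lemma integral_K_square_le:
  assumes g: "g \<in> borel_measurable \<mu>" "integrable \<mu> (\<lambda>y. (g y)\<^sup>2)"
  shows "(\<integral>y. K x y * g y \<partial>\<mu>)\<^sup>2 \<le> (\<integral>y. K x y \<partial>\<mu>) * (\<integral>y. K x y * (g y)\<^sup>2 \<partial>\<mu>)"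
proof -
  have gi: "integrable \<mu> g"
    by (rule square_integrable_imp_integrable[OF g])
  have eq: "sqrt (K x y) * (sqrt (K x y) * g y) = K x y * g y" "(sqrt (K x y))\<^sup>2 = K x y"
    "(sqrt (K x y) * g y)\<^sup>2 = K x y * (g y)\<^sup>2" for y
    using K_nonneg[of x y] by (simp_all add: mult.assoc[symmetric] power_mult_distrib)
  show ?thesis
    using integral_Cauchy_Schwarz[of \<mu> "\<lambda>y. sqrt (K x y)" "\<lambda>y. sqrt (K x y) * g y"]
      integrable_K[OF gi, of x] integrable_K[OF g(2), of x] integrable_K[of "\<lambda>_. 1" x]
    unfolding eq by simp
qed

lemma norm_ambient_grad_average_le:
  assumes u: "u \<in> borel_measurable \<mu>" "integrable \<mu> (\<lambda>y. (u y)\<^sup>2)"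
    and w: "0 < (\<integral>y. K x y \<partial>\<mu>)"
  shows "(norm (ambient_grad (\<lambda>x. (\<integral>y. K x y * u y \<partial>\<mu>) / (\<integral>y. K x y \<partial>\<mu>)) x))\<^sup>2
    \<le> 4 * A * measure \<mu> (M \<inter> ball x (3 * sqrt t)) / (t * (\<integral>y. K x y \<partial>\<mu>)\<^sup>2)
       * (\<integral>y. K x y * (u x - u y)\<^sup>2 \<partial>\<mu>)"
proof -
  let ?w = "\<integral>y. K x y \<partial>\<mu>" and ?S = "\<integral>y. K x y * (u x - u y)\<^sup>2 \<partial>\<mu>"
  let ?m = "measure \<mu> (M \<inter> ball x (3 * sqrt t))"
  \<comment> \<open>The value \<open>u x\<close> is frozen as a number, so that subtracting it
    contributes nothing when \<open>x\<close> moves under the derivative.\<close>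
  define c where "c = u x"
  define g where "g y = u y - c" for y
  have ui: "integrable \<mu> u" by (rule square_integrable_imp_integrable[OF u])
  have gm: "g \<in> borel_measurable \<mu>" unfolding g_def using u by simp
  have g2: "integrable \<mu> (\<lambda>y. (g y)\<^sup>2)"
    using ui u(2) by (simp add: g_def power2_diff)
  have gi: "integrable \<mu> g" by (rule square_integrable_imp_integrable[OF gm g2])
  have S: "?S = (\<integral>y. K x y * (g y)\<^sup>2 \<partial>\<mu>)"
    by (simp add: g_def c_def power2_commute)
  have S0: "0 \<le> ?S" by (rule integral_nonneg_AE) (simp add: K_nonneg)
  have one: "integrable \<mu> (\<lambda>_. 1::real)" by simp
  have du: "((\<lambda>x. \<integral>y. K x y * u y \<partial>\<mu>) has_derivative (\<lambda>h. \<integral>y. DK x h y * u y \<partial>\<mu>)) (at x)"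
    by (rule has_derivative_integral_K[OF ui])
  have dw: "((\<lambda>x. \<integral>y. K x y \<partial>\<mu>) has_derivative (\<lambda>h. \<integral>y. DK x h y \<partial>\<mu>)) (at x)"
    using has_derivative_integral_K[OF one] by simp
  define D where "D h = (\<integral>y. DK x h y * g y \<partial>\<mu>) / ?w
      - (\<integral>y. K x y * g y \<partial>\<mu>) * (\<integral>y. DK x h y \<partial>\<mu>) / ?w\<^sup>2" for h
  have Ku: "(\<integral>y. K x y * u y \<partial>\<mu>) = (\<integral>y. K x y * g y \<partial>\<mu>) + c * ?w"
  proof -
    have "(\<integral>y. K x y * u y \<partial>\<mu>) = (\<integral>y. K x y * g y + c * (K x y * 1) \<partial>\<mu>)"
      by (simp add: g_def algebra_simps)
    then show ?thesis
      using integrable_K[OF gi, of x] integrable_K[OF one, of x] by simp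
  qed
  have DKu: "(\<integral>y. DK x h y * u y \<partial>\<mu>) = (\<integral>y. DK x h y * g y \<partial>\<mu>) + c * (\<integral>y. DK x h y \<partial>\<mu>)" for h
  proof -
    have "(\<integral>y. DK x h y * u y \<partial>\<mu>) = (\<integral>y. DK x h y * g y + c * (DK x h y * 1) \<partial>\<mu>)"
      by (simp add: g_def algebra_simps)
    then show ?thesis
      using integrable_DK[OF gi, of x h] integrable_DK[OF one, of x h] by simp
  qed
  have "((\<lambda>x. (\<integral>y. K x y * u y \<partial>\<mu>) / (\<integral>y. K x y \<partial>\<mu>)) has_derivative D) (at x)"
  proof (rule has_derivative_eq_rhs[OF has_derivative_divide[OF du dw]])
    \<comment> \<open>The two terms of the quotient rule that contain \<open>c\<close> cancel,
      leaving only differences of \<open>u\<close>.\<close>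
    have "- (b + c * ?w) * (inverse ?w * p * inverse ?w) + (a + c * p) / ?w = a / ?w - b * p / ?w\<^sup>2" for a b p
      using w by (simp add: field_simps power2_eq_square)
    then show "(\<lambda>h. - (\<integral>y. K x y * u y \<partial>\<mu>) * (inverse ?w * (\<integral>y. DK x h y \<partial>\<mu>) * inverse ?w)
        + (\<integral>y. DK x h y * u y \<partial>\<mu>) / ?w) = D"
      by (simp only: D_def Ku DKu fun_eq_iff simp_thms)
  qed (use w in simp)
  moreover have "(D h)\<^sup>2 \<le> (4 * A * ?m / (t * ?w\<^sup>2) * ?S) * (norm h)\<^sup>2" for h
  proof -
    let ?a = "\<integral>y. DK x h y * g y \<partial>\<mu>" and ?b = "\<integral>y. K x y * g y \<partial>\<mu>" and ?p = "\<integral>y. DK x h y \<partial>\<mu>"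
    \<comment> \<open>\<open>?q\<close> arises twice: from \<open>integral_DK_square_le\<close> with
      \<open>g\<close> and with the constant 1. In the second case \<open>?w\<close> replaces
      \<open>?S\<close>, but the bound on \<open>?b\<close> supplies \<open>?S\<close> and another
      \<open>?w\<close>; these two factors reduce \<open>?w ^ 4\<close> to
      \<open>?w\<^sup>2\<close>, so both terms of \<open>D\<close> obey the same bound.\<close>
    let ?q = "?m * (A * (norm h)\<^sup>2 / t)"
    have q: "0 \<le> ?q" using A_pos t_pos by simp
    have a: "?a\<^sup>2 \<le> ?q * ?S"
      using integral_DK_square_le[OF gm g2, of x h] S by simp
    have b: "?b\<^sup>2 \<le> ?w * ?S"
      using integral_K_square_le[OF gm g2, of x] S by simp
    have p: "?p\<^sup>2 \<le> ?q * ?w"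
      using integral_DK_square_le[of "\<lambda>_. 1" x h] by simp
    have "(?b * ?p)\<^sup>2 \<le> (?w * ?S) * (?q * ?w)"
      unfolding power_mult_distrib using b p w S0 by (intro mult_mono) auto
    then have bp: "(?b * ?p / ?w\<^sup>2)\<^sup>2 \<le> ?q * ?S / ?w\<^sup>2"
      using w by (simp add: power_divide pos_divide_le_eq power2_eq_square mult_ac)
    have aw: "(?a / ?w)\<^sup>2 \<le> ?q * ?S / ?w\<^sup>2"
      unfolding power_divide by (rule divide_right_mono[OF a]) simp
    have "(r - s)\<^sup>2 \<le> 2 * r\<^sup>2 + 2 * s\<^sup>2" for r s :: real
      using zero_le_power2[of "r + s"] by (simp add: power2_eq_square algebra_simps)
    then have "(D h)\<^sup>2 \<le> 2 * (?a / ?w)\<^sup>2 + 2 * (?b * ?p / ?w\<^sup>2)\<^sup>2"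
      unfolding D_def .
    also have "\<dots> \<le> 4 * (?q * ?S / ?w\<^sup>2)" using aw bp by linarith
    also have "\<dots> = (4 * A * ?m / (t * ?w\<^sup>2) * ?S) * (norm h)\<^sup>2"
      by (simp add: field_simps)
    finally show ?thesis .
  qed
  ultimately show ?thesis by (rule norm_ambient_grad_le)
qed

end

section \<open>Matching the powers of \<open>t\<close> and the final estimate\<close>

lemma Ct_eq:
  assumes "t > 0"
  shows "Ct k t = (4 * pi) powr (- (real k / 2)) / sqrt t ^ k"
proof -
  have "Ct k t = (4 * pi) powr (- (real k / 2)) * t powr (- (real k / 2))"
    using assms by (simp add: Ct_def powr_mult)
  also have "t powr (- (real k / 2)) = 1 / sqrt t ^ k"
    using assms by (simp add: powr_minus_divide powr_half_sqrt[symmetric] powr_powr powr_realpow[symmetric])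
  finally show ?thesis by simp
qed

theorem theorem5:
  fixes M :: "(real^'d) set" and \<mu> :: "(real^'d) measure" and R :: "real \<Rightarrow> real"
  assumes "compact M"
    and "smooth_submanifold_with_boundary TYPE('k::finite) M"
    and "is_volume_measure TYPE('k) M \<mu>"
    and "kernel_ok R"
  shows "\<exists>C>0. \<exists>t0>0. \<forall>t. 0 < t \<and> t < t0 \<longrightarrow> (\<forall>u \<in> L2 \<mu>.
           (\<integral>x. u x * Lt CARD('k) R \<mu> t u x \<partial>\<mu>)
             \<ge> C * (\<integral>x. (norm (mgrad TYPE('k) M (vt CARD('k) R \<mu> t u) x))\<^sup>2 \<partial>\<mu>))"
proof -
  let ?k = "CARD('k)"
  obtain R' A B \<delta> where \<delta>: "\<delta> > 0" "\<And>r. 0 \<le> r \<Longrightarrow> r \<le> 1/2 \<Longrightarrow> \<delta> \<le> R r"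
    and A: "A > 0" and B: "B > 0"
    and R: "continuous_on {0..} R" "continuous_on {0..} R'"
    "\<And>r. r \<ge> 0 \<Longrightarrow> 0 \<le> R r" "\<And>r. r \<ge> 0 \<Longrightarrow> R r \<le> B" "\<And>r. r \<ge> 0 \<Longrightarrow> \<bar>R' r\<bar> \<le> B"
    "\<And>r. r > 1 \<Longrightarrow> R r = 0" "\<And>r. r \<ge> 0 \<Longrightarrow> (R' r)\<^sup>2 \<le> A * R r"
    "\<And>r s. r \<ge> 0 \<Longrightarrow> s \<ge> 0 \<Longrightarrow> \<bar>R s - R r - R' r * (s - r)\<bar> \<le> B * (s - r)\<^sup>2"
    by (rule kernel_ok_bounds[OF assms(4)]) (rule that)
  obtain e c C where e: "0 < e" and c: "0 < c" and C: "0 < C"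
    and lo: "\<And>x r. x \<in> M \<Longrightarrow> 0 < r \<Longrightarrow> r < e \<Longrightarrow> ennreal (c * r ^ ?k) \<le> emeasure \<mu> (M \<inter> ball x r)"
    and up: "\<And>x r. x \<in> M \<Longrightarrow> 0 < r \<Longrightarrow> r < e \<Longrightarrow> emeasure \<mu> (M \<inter> ball x r) \<le> ennreal (C * r ^ ?k)"
    by (rule volume_measure_ball_bounds[OF assms(2,3,1)]) (rule that)
  interpret finite_measure \<mu> by (rule volume_measure_finite[OF assms(2,3,1)])
  \<comment> \<open>From the factor \<open>4 * A * m / (t * w\<^sup>2)\<close> of the gradient
    bound, with ball mass \<open>m \<le> C * (3 * s) ^ k\<close> and
    \<open>w \<ge> \<delta> * c * s ^ k\<close>; the powers of \<open>s\<close> and the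
    \<open>1 / t\<close> are kept apart.\<close>
  define E where "E = 4 * A * C * 3 ^ ?k / (\<delta> * c)\<^sup>2"
  define G where "G = (4 * pi) powr (- (real ?k / 2))"
  have E: "E > 0" using A C \<delta> c by (simp add: E_def)
  have G: "G > 0" by (simp add: G_def)
  \<comment> \<open>\<open>G / s ^ k\<close> is \<open>Ct\<close>, and the 2 comes from
    symmetrisation. The restriction on \<open>t\<close> says \<open>3 * sqrt t < e\<close>, so the
    volume bounds hold for both radii used, \<open>sqrt t\<close> and
    \<open>3 * sqrt t\<close>.\<close>
  have "G / (2 * E) * (\<integral>x. (norm (mgrad TYPE('k) M (vt ?k R \<mu> t u) x))\<^sup>2 \<partial>\<mu>) \<le> (\<integral>x. u x * Lt ?k R \<mu> t u x \<partial>\<mu>)"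
    if t: "0 < t" "t < (e / 3)\<^sup>2" and u: "u \<in> L2 \<mu>" for t u
  proof -
    interpret kernel_smoothing \<mu> M R R' A B t
      using assms(1,3) t A B R by unfold_locales (auto simp: is_volume_measure_def compact_imp_bounded)
    have um: "u \<in> borel_measurable \<mu>" and u2: "integrable \<mu> (\<lambda>x. (u x)\<^sup>2)" using u by (auto simp: L2_def)
    define s where "s = sqrt t"
    have s: "s > 0" "3 * s < e" and st: "s\<^sup>2 = t"
      using t real_sqrt_less_mono[OF t(2)] e by (auto simp: s_def)
    define S where "S x = (\<integral>y. K x y * (u x - u y)\<^sup>2 \<partial>\<mu>)" for x
    have S0: "0 \<le> S x" for x unfolding S_def by (rule integral_nonneg_AE) (simp add: K_nonneg)
    have SI: "integrable \<mu> S"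
      unfolding S_def
      by (rule double_integral_symmetric_difference(1)[OF K_pair_measurable _ K_sym um u2, where B = B])
        (simp add: K_nonneg K_le)
    have Ct: "Ct ?k t = G / s ^ ?k" using Ct_eq[OF t(1)] by (simp add: G_def s_def)
    then have Ct0: "Ct ?k t > 0" using G s by simp
    have "u x * Lt ?k R \<mu> t u x = Ct ?k t / t * (u x * (\<integral>y. K x y * (u x - u y) \<partial>\<mu>))" for x
      by (simp add: Lt_def Rt_def K_def mult.assoc)
    then have "(\<integral>x. u x * Lt ?k R \<mu> t u x \<partial>\<mu>) = Ct ?k t / t * (\<integral>x. u x * (\<integral>y. K x y * (u x - u y) \<partial>\<mu>) \<partial>\<mu>)"
      by simp
    also have "(\<integral>x. u x * (\<integral>y. K x y * (u x - u y) \<partial>\<mu>) \<partial>\<mu>) = (1/2) * (\<integral>x. S x \<partial>\<mu>)"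
      unfolding S_def
      by (rule double_integral_symmetric_difference(2)[OF K_pair_measurable _ K_sym um u2, where B = B])
        (simp add: K_nonneg K_le)
    finally have LHS: "(\<integral>x. u x * Lt ?k R \<mu> t u x \<partial>\<mu>) = Ct ?k t / (2 * t) * (\<integral>x. S x \<partial>\<mu>)"
      by simp
    have vt: "vt ?k R \<mu> t u = (\<lambda>x. (\<integral>y. K x y * u y \<partial>\<mu>) / (\<integral>y. K x y \<partial>\<mu>))"
      using Ct0 by (simp add: vt_def wt_def K_def fun_eq_iff)
    have bound: "(norm (mgrad TYPE('k) M (vt ?k R \<mu> t u) x))\<^sup>2 \<le> E / (t * s ^ ?k) * S x"
      if x: "x \<in> M" for x
    proof -
      let ?w = "\<integral>y. K x y \<partial>\<mu>" and ?B = "M \<inter> ball x s"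
      have B: "?B \<in> sets \<mu>" unfolding sets_\<mu> by (auto simp: sets_restrict_space)
      \<comment> \<open>Within distance \<open>s\<close> of \<open>x\<close> the kernel argument is
        at most 1/4, where \<open>R\<close> is at least \<open>\<delta>\<close>; this ball alone
        bounds \<open>?w\<close> from below.\<close>
      have "c * s ^ ?k \<le> measure \<mu> ?B"
        using lo[OF x s(1)] s by (simp add: emeasure_eq_measure)
      then have "\<delta> * (c * s ^ ?k) \<le> \<delta> * measure \<mu> ?B" using \<delta>(1) by simp
      also have "\<dots> = (\<integral>y. \<delta> * indicator ?B y \<partial>\<mu>)"
        using B by (simp add: space_\<mu> Int_absorb2)
      also have "\<dots> \<le> ?w"
      proof (rule integral_mono)
        show "integrable \<mu> (\<lambda>y. \<delta> * indicator ?B y)"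
          using B by (simp add: emeasure_eq_measure)
        show "integrable \<mu> (K x)" using integrable_K[of "\<lambda>_. 1" x] by simp
        show "\<delta> * indicator ?B y \<le> K x y" for y
        proof (cases "y \<in> ?B")
          case True
          then have "(norm (x - y))\<^sup>2 \<le> s\<^sup>2" by (intro power_mono) (auto simp: dist_norm)
          then have "\<delta> \<le> K x y"
            unfolding K_def using t(1) st by (intro \<delta>(2)) (auto simp: field_simps)
          then show ?thesis using True by simp
        qed (simp add: K_nonneg)
      qed
      finally have w: "\<delta> * c * s ^ ?k \<le> ?w" by (simp add: mult.assoc)
      have w0: "0 < \<delta> * c * s ^ ?k" using \<delta> c s by simp
      have m: "measure \<mu> (M \<inter> ball x (3 * s)) \<le> C * (3 * s) ^ ?k"
        using up[OF x, of "3 * s"] s C by (simp add: emeasure_eq_measure)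
      have "(norm (mgrad TYPE('k) M (vt ?k R \<mu> t u) x))\<^sup>2 \<le> (norm (ambient_grad (vt ?k R \<mu> t u) x))\<^sup>2"
        by (intro power_mono norm_mgrad_le assms x) simp
      also have "\<dots> \<le> 4 * A * measure \<mu> (M \<inter> ball x (3 * s)) / (t * ?w\<^sup>2) * S x"
        unfolding vt S_def s_def using w w0 by (intro norm_ambient_grad_average_le um u2) simp
      also have "\<dots> \<le> 4 * A * (C * (3 * s) ^ ?k) / (t * (\<delta> * c * s ^ ?k)\<^sup>2) * S x"
        using m w w0 A t C s \<delta>(1) c by (intro mult_right_mono S0 frac_le mult_left_mono power_mono) auto
      also have "4 * A * (C * (3 * s) ^ ?k) / (t * (\<delta> * c * s ^ ?k)\<^sup>2) = E / (t * s ^ ?k)"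
        using s \<delta> c t by (simp add: E_def power_mult_distrib power2_eq_square field_simps)
      finally show ?thesis .
    qed
    \<comment> \<open>Only the majorant is shown to be integrable. Were the squared gradient not
      integrable, its Bochner integral would be 0 by convention, and the inequality would still hold
      because \<open>S\<close> is nonnegative.\<close>
    have "(\<integral>x. (norm (mgrad TYPE('k) M (vt ?k R \<mu> t u) x))\<^sup>2 \<partial>\<mu>) \<le> (\<integral>x. E / (t * s ^ ?k) * S x \<partial>\<mu>)"
      using SI bound S0 E t s by (intro integral_mono') (auto simp: space_\<mu>)
    then have "G / (2 * E) * (\<integral>x. (norm (mgrad TYPE('k) M (vt ?k R \<mu> t u) x))\<^sup>2 \<partial>\<mu>)
        \<le> G / (2 * E) * (E / (t * s ^ ?k) * (\<integral>x. S x \<partial>\<mu>))"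
      using G E by (intro mult_left_mono) auto
    also have "\<dots> = Ct ?k t / (2 * t) * (\<integral>x. S x \<partial>\<mu>)"
      using E by (simp add: Ct)
    finally show ?thesis using LHS by simp
  qed
  moreover have "G / (2 * E) > 0" "(e / 3)\<^sup>2 > 0" using G E e by auto
  ultimately show ?thesis by blast
qed

end
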